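(* Let $Q$ be a real field and let $Q \subseteq L$ be a repeated radical extension such that the degree $|L:Q|$ is odd. If $K$ is a field with $Q \subseteq K \subseteq L$, then $K$ is a repeated radical extension of $Q$.
   Context: A real field is a subfield of the real numbers $\mathbb{R}$. (The field $L$ is not assumed to be real.) A field extension $F \subseteq L$ is a radical extension if $L = F[\alpha]$ for some $\alpha \in L$ with $\alpha^n \in F$ for some positive integer $n$. An extension $F \subseteq L$ is a repeated radical extension if there are intermediate fields $F = L_0 \subseteq L_1 \subseteq \cdots \subseteq L_r = L$ such that $L_i$ is a radical extension of $L_{i-1}$ for $0 < i \le r$. $|L:Q|$ denotes the degree of the field extension. *)

theory Defs
  imports "HOL-Algebra.Algebra" "HOL-Algebra.Algebraic_Closure_Type"
begin

text \<open>
  A real field is a subfield of the field of real numbers. A field that is given abstractly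
  (e.g. as a subset of some other field) is real if it is such a subfield up to isomorphism.
\<close>

definition is_real_field :: "('a, 'b) ring_scheme \<Rightarrow> bool" where
  "is_real_field F \<longleftrightarrow>
     (\<exists>S. subfield S (ring_of_type_algebra :: real ring) \<and>
          F \<simeq> (ring_of_type_algebra :: real ring) \<lparr> carrier := S \<rparr>)"

text \<open>
  Below, \<open>F\<close> and \<open>E\<close> are subfields of the ambient ring \<open>R\<close>, and \<open>simple_extension F \<alpha>\<close>
  is \<open>F[\<alpha>]\<close>.
\<close>

definition (in ring) radical_extension :: "'a set \<Rightarrow> 'a set \<Rightarrow> bool" where
  "radical_extension F E \<longleftrightarrow>
     subfield F R \<and> subfield E R \<and> F \<subseteq> E \<and>
     (\<exists>\<alpha>\<in>E. (\<exists>n::nat. n > 0 \<and> \<alpha> [^] n \<in> F) \<and> E = simple_extension F \<alpha>)"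

definition (in ring) repeated_radical_extension :: "'a set \<Rightarrow> 'a set \<Rightarrow> bool" where
  "repeated_radical_extension F E \<longleftrightarrow>
     (\<exists>(r::nat) (L::nat \<Rightarrow> 'a set).
        L 0 = F \<and> L r = E \<and> (\<forall>i\<le>r. subfield (L i) R) \<and>
        (\<forall>i<r. radical_extension (L i) (L (Suc i))))"

end

theory Submission
  imports Defs
begin

text \<open>
  Since all degrees are odd, the minimal polynomials of the successive radicals have real
  roots, and a real embedding of \<open>Q\<close> extends to all of \<open>L\<close>
  (\<open>repeated_radical_odd_embedding\<close>). So \<open>L\<close> may be taken to be a subfield of the reals
  that is obtained from \<open>Q\<close> by successively adjoining real roots of odd prime exponents.
  Such chains are called towers, and an induction on their length shows that intermediate
  fields again have towers (\<open>radical_tower_intermediate\<close>).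

  Let \<open>cyclotomic S\<close> be \<open>S\<close> with all roots of unity. If \<open>S\<close> is real and \<open>T\<close> has a tower
  over \<open>S\<close>, then \<open>T\<close> meets \<open>cyclotomic S\<close> in \<open>S\<close> only (\<open>radical_tower_inter_cyclotomic\<close>),
  because the conjugates of a real element of an abelian extension of \<open>S\<close> are real, while
  those of a real radical are not. In particular a new real radical \<open>a\<close> has the conjugates
  \<open>u a\<close>, for \<open>p\<close>-th roots of unity \<open>u\<close>, even over \<open>cyclotomic S\<close>. Moreover, an element \<open>x\<close>
  of \<open>cyclotomic T\<close> with \<open>\<bar>x\<bar> = 1\<close> and some power in \<open>cyclotomic S\<close> is in \<open>cyclotomic S\<close>
  (\<open>radical_tower_unit_cyclotomic\<close>), because in each step \<open>x\<close> is by Kummer theory a power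
  of a real radical times an element of the smaller field, and the real radical does not
  contribute to the argument of \<open>x\<close>.

  Let \<open>Q \<subseteq> K \<subseteq> L\<close>, let \<open>F = Q(a)\<close> be the first field of the tower of \<open>L\<close> over \<open>Q\<close>, and
  suppose that \<open>a\<close> is not in \<open>K\<close>. By induction over \<open>F\<close> one can shrink \<open>L\<close> to \<open>K(a)\<close>. Let
  \<open>b\<close> be the first radical of \<open>L\<close> over \<open>F\<close>, say \<open>b ^ l\<close> is in \<open>F\<close>. The quotient of a
  conjugate of \<open>b\<close> over \<open>cyclotomic K\<close> by its complex conjugate has modulus one, so it is
  in \<open>cyclotomic F\<close>. From this it follows that all conjugates of \<open>b\<close> over \<open>cyclotomic K\<close>
  are multiples of \<open>b\<close> by elements of \<open>cyclotomic F\<close>, and so are the coefficients of \<open>b\<close>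
  with respect to the powers of \<open>a\<close>. Hence the \<open>l\<close>-th powers of these coefficients, which
  are elements of \<open>K\<close>, are in \<open>Q\<close> (\<open>radical_in_subfield\<close>). At least one coefficient \<open>c\<close> is
  not in \<open>Q\<close>. The tower of \<open>L\<close> over \<open>Q(c)\<close> is shorter than that over \<open>Q\<close>, and so by
  induction \<open>K\<close> has a tower over \<open>Q(c)\<close>.

  Instead of automorphisms, the proofs use that a polynomial relation for a radical is
  inherited by its conjugates, so that no Galois closure is ever formed.
\<close>

hide_const (open) Divisibility.prime UnivPoly.coeff UnivPoly.monom

section \<open>Subfields of the complex numbers and polynomials over them\<close>

definition complex_subfield :: "complex set \<Rightarrow> bool" where
  "complex_subfield S \<longleftrightarrow>
     1 \<in> S \<and> (\<forall>x\<in>S. \<forall>y\<in>S. x - y \<in> S \<and> x * y \<in> S) \<and> (\<forall>x\<in>S. inverse x \<in> S)"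

definition poly_over :: "complex set \<Rightarrow> complex poly \<Rightarrow> bool" where
  "poly_over S p \<longleftrightarrow> (\<forall>i. coeff p i \<in> S)"

definition adjoin :: "complex set \<Rightarrow> complex \<Rightarrow> complex set" where
  "adjoin S x = {poly p x | p. poly_over S p}"

context
  fixes S assumes S: "complex_subfield S"
begin

lemma csf_1: "1 \<in> S"
  and csf_diff: "x \<in> S \<Longrightarrow> y \<in> S \<Longrightarrow> x - y \<in> S"
  and csf_mult: "x \<in> S \<Longrightarrow> y \<in> S \<Longrightarrow> x * y \<in> S"
  and csf_inverse: "x \<in> S \<Longrightarrow> inverse x \<in> S"
  using S by (auto simp: complex_subfield_def)

lemma csf_0: "0 \<in> S"
  using csf_diff[OF csf_1 csf_1] by simp

lemma csf_uminus: "x \<in> S \<Longrightarrow> - x \<in> S"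
  using csf_diff[OF csf_0] by force

lemma csf_add: "x \<in> S \<Longrightarrow> y \<in> S \<Longrightarrow> x + y \<in> S"
  using csf_diff[OF _ csf_uminus] by force

lemma csf_divide: "x \<in> S \<Longrightarrow> y \<in> S \<Longrightarrow> x / y \<in> S"
  by (simp add: divide_inverse csf_mult csf_inverse)

lemma csf_power: "x \<in> S \<Longrightarrow> x ^ n \<in> S"
  by (induction n) (auto intro: csf_1 csf_mult)

lemma csf_sum: "(\<And>i. i \<in> A \<Longrightarrow> f i \<in> S) \<Longrightarrow> sum f A \<in> S"
  by (induction A rule: infinite_finite_induct) (auto intro: csf_0 csf_add)

lemma csf_of_nat: "of_nat n \<in> S"
  by (induction n) (auto intro: csf_1 csf_0 csf_add)

lemmas csf_intros = csf_0 csf_1 csf_diff csf_mult csf_inverse csf_uminus csf_add csf_divide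
  csf_power csf_sum csf_of_nat

text \<open>
  A Bezout relation between \<open>m\<close> and \<open>n\<close> writes \<open>x\<close> as a product of integer powers of \<open>x ^
  m\<close> and \<open>x ^ n\<close>.
\<close>

lemma coprime_powers_mem:
  fixes x :: complex
  assumes "x ^ m \<in> S" "x ^ n \<in> S" "coprime m n"
  shows "x \<in> S"
proof (cases "x = 0")
  case False
  obtain u v :: int where uv: "u * int m + v * int n = 1"
    using assms(3) bezout_int[of "int m" "int n"] by (auto simp: coprime_iff_gcd_eq_1)
  have powi: "y powi k \<in> S" if "y \<in> S" for y k
    using that by (simp add: power_int_def csf_power csf_inverse)
  have "x = x powi (u * int m + v * int n)"
    unfolding uv by simp
  also have "\<dots> = x powi (int m * u) * x powi (int n * v)"
    using False by (simp add: power_int_add mult.commute)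
  also have "\<dots> = (x ^ m) powi u * (x ^ n) powi v"
    by (simp add: power_int_mult)
  also have "\<dots> \<in> S"
    by (intro csf_mult powi assms)
  finally show ?thesis .
qed (simp add: csf_0)

lemma poly_over_0: "poly_over S 0" and poly_over_1: "poly_over S 1"
  by (auto simp: poly_over_def csf_0 csf_1)

lemma poly_over_const: "c \<in> S \<Longrightarrow> poly_over S [:c:]"
  by (auto simp: poly_over_def csf_0 coeff_pCons split: nat.splits)

lemma poly_over_pCons: "c \<in> S \<Longrightarrow> poly_over S p \<Longrightarrow> poly_over S (pCons c p)"
  by (auto simp: poly_over_def coeff_pCons split: nat.splits)

lemma poly_over_monom: "c \<in> S \<Longrightarrow> poly_over S (monom c n)"
  by (auto simp: poly_over_def csf_0)

lemma poly_over_add: "poly_over S p \<Longrightarrow> poly_over S q \<Longrightarrow> poly_over S (p + q)"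
  and poly_over_diff: "poly_over S p \<Longrightarrow> poly_over S q \<Longrightarrow> poly_over S (p - q)"
  and poly_over_uminus: "poly_over S p \<Longrightarrow> poly_over S (- p)"
  and poly_over_smult: "c \<in> S \<Longrightarrow> poly_over S p \<Longrightarrow> poly_over S (Polynomial.smult c p)"
  by (auto simp: poly_over_def csf_add csf_diff csf_mult csf_uminus)

lemma poly_over_mult: "poly_over S p \<Longrightarrow> poly_over S q \<Longrightarrow> poly_over S (p * q)"
  by (auto simp: poly_over_def coeff_mult intro!: csf_sum csf_mult)

lemma poly_over_power: "poly_over S p \<Longrightarrow> poly_over S (p ^ n)"
  by (induction n) (auto intro: poly_over_1 poly_over_mult)

lemma poly_over_pcompose: "poly_over S p \<Longrightarrow> poly_over S q \<Longrightarrow> poly_over S (pcompose p q)"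
  unfolding poly_over_def by (auto intro!: coeff_pcompose_semiring_closed csf_intros)

lemmas poly_over_intros = poly_over_0 poly_over_1 poly_over_const poly_over_pCons poly_over_monom
  poly_over_add poly_over_diff poly_over_uminus poly_over_smult poly_over_mult poly_over_power
  poly_over_pcompose

lemma poly_mem: "poly_over S p \<Longrightarrow> x \<in> S \<Longrightarrow> poly p x \<in> S"
  by (auto simp: poly_over_def poly_altdef intro!: csf_sum csf_mult csf_power)

text \<open>
  Division of complex polynomials never leaves the field of coefficients. The quotient is
  built by cancelling leading terms, which keeps both quotient and remainder visibly over
  \<open>S\<close>.
\<close>

lemma poly_over_division:
  assumes g: "poly_over S g" "g \<noteq> 0" and p: "poly_over S p"
  shows "\<exists>h r. poly_over S h \<and> poly_over S r \<and> p = h * g + r \<and> (r = 0 \<or> degree r < degree g)"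
  using p
proof (induction "degree p" arbitrary: p rule: less_induct)
  case less
  show ?case
  proof (cases "p = 0 \<or> degree p < degree g")
    case True
    thus ?thesis
      using less.prems by (intro exI[of _ 0] exI[of _ p]) (auto simp: poly_over_0)
  next
    case False
    define m where "m = monom (lead_coeff p / lead_coeff g) (degree p - degree g)"
    define p' where "p' = p - m * g"
    have m: "poly_over S m"
      unfolding m_def using g less.prems
      by (intro poly_over_monom csf_divide) (auto simp: poly_over_def)
    have p': "poly_over S p'"
      unfolding p'_def using less.prems g(1) m by (intro poly_over_intros)
    have lc: "lead_coeff p / lead_coeff g \<noteq> 0"
      using False g by auto
    have "m \<noteq> 0"
      using lc by (simp add: m_def)
    have dm: "degree m = degree p - degree g"
      unfolding m_def by (rule degree_monom_eq[OF lc])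
    have dmg: "degree (m * g) = degree p"
      using \<open>m \<noteq> 0\<close> g(2) dm False by (simp add: degree_mult_eq)
    have "lead_coeff m = lead_coeff p / lead_coeff g"
      unfolding m_def by (rule lead_coeff_monom)
    hence "lead_coeff (m * g) = lead_coeff p"
      using g(2) by (simp add: lead_coeff_mult)
    hence *: "coeff p' (degree p) = 0"
      using dmg by (simp add: p'_def)
    have dle: "degree p' \<le> degree p"
      unfolding p'_def using dmg by (metis degree_diff_le order_refl)
    show ?thesis
    proof (cases "degree p' < degree p")
      case True
      obtain h r where "poly_over S h" "poly_over S r" "p' = h * g + r" "r = 0 \<or> degree r < degree g"
        using less.hyps[OF True p'] by blast
      thus ?thesis
        using m by (intro exI[of _ "h + m"] exI[of _ r])
          (auto intro!: poly_over_intros simp: p'_def algebra_simps)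
    next
      case False
      hence "p' = 0"
        using * dle by (metis leading_coeff_0_iff le_neq_implies_less)
      thus ?thesis
        using m by (intro exI[of _ m] exI[of _ 0]) (auto simp: p'_def poly_over_0)
    qed
  qed
qed

text \<open>
  The minimal polynomial of an algebraic number. Besides the divisibility of all other
  polynomials that vanish at \<open>x\<close>, the form with degrees is stated because it expresses the
  linear independence of the powers of \<open>x\<close>.
\<close>

lemma minimal_polynomial:
  assumes "poly_over S p" "p \<noteq> 0" "poly p x = 0"
  obtains f where "poly_over S f" "lead_coeff f = 1" "poly f x = 0" "degree f > 0"
    "\<And>g. poly_over S g \<Longrightarrow> poly g x = 0 \<Longrightarrow> f dvd g"
    "\<And>g. poly_over S g \<Longrightarrow> poly g x = 0 \<Longrightarrow> degree g < degree f \<Longrightarrow> g = 0"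
proof -
  define P where "P = (\<lambda>g. poly_over S g \<and> g \<noteq> 0 \<and> poly g x = 0)"
  obtain f0 where f0: "P f0" and min: "\<And>g. P g \<Longrightarrow> degree f0 \<le> degree g"
    using ex_has_least_nat[of P p degree] assms by (auto simp: P_def)
  define f where "f = Polynomial.smult (inverse (lead_coeff f0)) f0"
  have f: "poly_over S f" "f \<noteq> 0" "poly f x = 0" "lead_coeff f = 1" "degree f = degree f0"
    using f0 by (auto simp: f_def P_def intro!: poly_over_smult csf_inverse)
      (auto simp: poly_over_def)
  have zero: "g = 0" if "poly_over S g" "poly g x = 0" "degree g < degree f" for g
    using min[of g] that f(5) by (auto simp: P_def)
  show ?thesis
  proof (rule that[OF f(1,4,3) _ _ zero])
    show "degree f > 0"
    proof (rule ccontr)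
      assume "\<not> degree f > 0"
      then obtain c where "f = [:c:]"
        using degree_eq_zeroE by blast
      thus False
        using f by simp
    qed
    fix g assume g: "poly_over S g" "poly g x = 0"
    obtain h r where hr: "poly_over S h" "poly_over S r" "g = h * f + r" "r = 0 \<or> degree r < degree f"
      using poly_over_division[OF f(1,2) g(1)] by blast
    have "poly r x = 0"
      using hr(3) g(2) f(3) by simp
    hence "r = 0"
      using hr zero by blast
    thus "f dvd g"
      using hr(3) by simp
  qed
qed

text \<open>
  For algebraic \<open>x\<close> the ring \<open>S[x]\<close> is a field: with \<open>f\<close> the minimal polynomial of \<open>x\<close>,
  dividing \<open>f\<close> by \<open>g\<close> expresses the value of the remainder at \<open>x\<close> as a multiple of the
  value of \<open>g\<close>, so inverses are obtained by descent on the degree.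
\<close>

lemma adjoin_is_subfield:
  assumes "poly_over S p" "p \<noteq> 0" "poly p x = 0"
  shows "complex_subfield (adjoin S x)"
proof -
  obtain f where f: "poly_over S f" "lead_coeff f = 1" "poly f x = 0"
    and dvd: "\<And>g. poly_over S g \<Longrightarrow> poly g x = 0 \<Longrightarrow> f dvd g"
    and zero: "\<And>g. poly_over S g \<Longrightarrow> poly g x = 0 \<Longrightarrow> degree g < degree f \<Longrightarrow> g = 0"
    using minimal_polynomial[OF assms] by metis
  have f0: "f \<noteq> 0" using f(2) by auto
  have inv: "\<exists>h. poly_over S h \<and> poly h x * poly g x = 1"
    if "poly_over S g" "g \<noteq> 0" "degree g < degree f" for g
    using that
  proof (induction "degree g" arbitrary: g rule: less_induct)
    case less
    show ?case
    proof (cases "degree g = 0")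
      case True
      then obtain c where c: "g = [:c:]"
        using degree_eq_zeroE by blast
      have "c \<in> S" "c \<noteq> 0"
        using less.prems c by (auto simp: poly_over_def dest: spec[of _ 0])
      thus ?thesis
        by (intro exI[of _ "[:inverse c:]"]) (auto simp: c intro!: poly_over_const csf_inverse)
    next
      case False
      obtain h r where hr: "poly_over S h" "poly_over S r" "f = h * g + r" "r = 0 \<or> degree r < degree g"
        using poly_over_division[OF less.prems(1,2) f(1)] by blast
      have gx: "poly g x \<noteq> 0"
        using zero less.prems by blast
      have "r \<noteq> 0"
      proof
        assume "r = 0"
        hence fh: "f = h * g" using hr by simp
        hence "poly h x = 0" using f(3) gx by simp
        moreover have "h \<noteq> 0" using fh f0 by auto
        moreover have "degree h < degree f"
          using fh \<open>h \<noteq> 0\<close> less.prems(2) False by (simp add: degree_mult_eq)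
        ultimately show False
          using zero hr(1) by blast
      qed
      then obtain s where s: "poly_over S s" "poly s x * poly r x = 1"
        using less.hyps[of r] hr less.prems by force
      have "poly r x = - poly h x * poly g x"
        using f(3) hr(3) by (simp add: eq_neg_iff_add_eq_0 add.commute)
      thus ?thesis
        using s hr(1) by (intro exI[of _ "- s * h"]) (auto intro!: poly_over_intros simp: algebra_simps)
    qed
  qed
  have "inverse y \<in> adjoin S x" if y: "y \<in> adjoin S x" for y
  proof (cases "y = 0")
    case True
    thus ?thesis using y by simp
  next
    case False
    obtain g where g: "poly_over S g" "y = poly g x"
      using y by (auto simp: adjoin_def)
    obtain h r where hr: "poly_over S h" "poly_over S r" "g = h * f + r" "r = 0 \<or> degree r < degree f"
      using poly_over_division[OF f(1) f0 g(1)] by blast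
    have y: "y = poly r x"
      using g hr f by simp
    hence "r \<noteq> 0" using False by auto
    then obtain s where "poly_over S s" "poly s x * poly r x = 1"
      using inv[of r] hr by auto
    moreover from this have "inverse y = poly s x"
      unfolding y using inverse_unique[of "poly r x"] by (metis mult.commute)
    ultimately show ?thesis
      by (auto simp: adjoin_def)
  qed
  moreover have "1 \<in> adjoin S x"
    unfolding adjoin_def using poly_over_1 poly_1 by (metis (mono_tags, lifting) mem_Collect_eq)
  moreover have "y - z \<in> adjoin S x" "y * z \<in> adjoin S x" if "y \<in> adjoin S x" "z \<in> adjoin S x" for y z
  proof -
    obtain g h where "poly_over S g" "y = poly g x" "poly_over S h" "z = poly h x"
      using \<open>y \<in> _\<close> \<open>z \<in> _\<close> by (auto simp: adjoin_def)
    hence "y - z = poly (g - h) x" "y * z = poly (g * h) x" "poly_over S (g - h)" "poly_over S (g * h)"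
      by (auto intro: poly_over_intros)
    thus "y - z \<in> adjoin S x" "y * z \<in> adjoin S x"
      unfolding adjoin_def by blast+
  qed
  ultimately show ?thesis
    unfolding complex_subfield_def by blast
qed

lemma subset_adjoin: "S \<subseteq> adjoin S x"
proof
  fix c assume "c \<in> S"
  thus "c \<in> adjoin S x"
    unfolding adjoin_def using poly_over_const[of c] by (auto intro!: exI[of _ "[:c:]"])
qed

lemma mem_adjoin: "x \<in> adjoin S x"
  unfolding adjoin_def using poly_over_pCons[OF csf_0 poly_over_1]
  by (auto intro!: exI[of _ "[:0,1:]"] simp: one_pCons)

lemma poly_over_radical: "a \<in> S \<Longrightarrow> poly_over S (monom 1 n - [:a:])"
  by (intro poly_over_intros csf_1)

end

lemma poly_radical [simp]: "poly (monom 1 n - [:a:]) (x::complex) = x ^ n - a"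
  by (simp add: poly_monom)

lemma degree_radical: "n > 0 \<Longrightarrow> degree (monom 1 n - [:a::complex:]) = n"
  by (metis (no_types) add_uminus_conv_diff degree_add_eq_left degree_minus degree_monom_eq
      degree_pCons_0 zero_neq_one)

lemma radical_nonzero: "n > 0 \<Longrightarrow> monom 1 n - [:a::complex:] \<noteq> 0"
  using degree_radical[of n a] by force

lemma poly_over_mono: "S \<subseteq> T \<Longrightarrow> poly_over S p \<Longrightarrow> poly_over T p"
  by (auto simp: poly_over_def)

lemma adjoin_subset:
  assumes "complex_subfield T" "S \<subseteq> T" "x \<in> T"
  shows "adjoin S x \<subseteq> T"
  using poly_mem[OF assms(1) poly_over_mono[OF assms(2)] assms(3)] by (auto simp: adjoin_def)

lemma adjoin_mono: "S \<subseteq> T \<Longrightarrow> adjoin S x \<subseteq> adjoin T x"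
  by (auto simp: adjoin_def intro: poly_over_mono)

lemma adjoin_mem_eq:
  assumes "complex_subfield S" "x \<in> S"
  shows "adjoin S x = S"
  using adjoin_subset[OF assms(1) _ assms(2)] subset_adjoin[OF assms(1)] by blast

lemma adjoin_radical_subfield:
  assumes S: "complex_subfield S" and n: "n > 0" and a: "x ^ n \<in> S"
  shows "complex_subfield (adjoin S x)"
  by (rule adjoin_is_subfield[OF S poly_over_radical[OF S a, of n] radical_nonzero[OF n]]) (simp add: poly_monom)

lemma adjoin_radical_reduced:
  assumes S: "complex_subfield S" and n: "n > 0" and a: "x ^ n \<in> S" and y: "y \<in> adjoin S x"
  obtains g where "poly_over S g" "degree g < n" "y = poly g x"
proof -
  obtain g where g: "poly_over S g" "y = poly g x"
    using y by (auto simp: adjoin_def)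
  obtain h r where hr: "poly_over S r" "g = h * (monom 1 n - [:x ^ n:]) + r"
      "r = 0 \<or> degree r < degree (monom 1 n - [:x ^ n:])"
    using poly_over_division[OF S poly_over_radical[OF S a, of n] radical_nonzero[OF n] g(1)] by blast
  have "y = poly r x"
    unfolding g(2) hr(2) by (simp add: poly_monom)
  moreover have "degree r < n"
    using hr(3) n degree_radical[OF n] by auto
  ultimately show ?thesis
    using that hr(1) by blast
qed

section \<open>Adjoining all roots of unity\<close>

text \<open>
  The field obtained from \<open>S\<close> by adjoining all roots of unity. Finitely many roots of
  unity are powers of a single one, so each element is already a polynomial in one root of
  unity; this form makes explicit conjugates available.
\<close>

definition cyclotomic :: "complex set \<Rightarrow> complex set" where
  "cyclotomic S = {poly p w | p w. poly_over S p \<and> (\<exists>m>0. w ^ m = 1)}"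

lemma common_root_of_unity:
  fixes v w :: complex
  assumes "w ^ m = 1" "m > 0" "v ^ n = 1" "n > 0"
  obtains z i j where "z ^ (m * n) = 1" "w = z ^ i" "v = z ^ j"
proof -
  define z where "z = cis (2 * pi / real (m * n))"
  obtain k where "w = cis (2 * pi * real k / real m)"
    using bij_betw_roots_unity[OF assms(2)] assms(1) unfolding bij_betw_def by blast
  hence "w = z ^ (k * n)"
    using assms(2,4) by (simp add: z_def DeMoivre field_simps)
  moreover obtain l where "v = cis (2 * pi * real l / real n)"
    using bij_betw_roots_unity[OF assms(4)] assms(3) unfolding bij_betw_def by blast
  hence "v = z ^ (l * m)"
    using assms(2,4) by (simp add: z_def DeMoivre field_simps)
  moreover have "z ^ (m * n) = 1"
    using assms(2,4) by (simp add: z_def DeMoivre)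
  ultimately show ?thesis
    using that by blast
qed

lemma cnj_root_of_unity:
  fixes w :: complex
  assumes "w ^ m = 1" "m > 0"
  shows "cnj w = w ^ (m - 1)"
proof -
  have "cmod w ^ m = 1"
    using assms(1) by (metis norm_one norm_power)
  hence "cmod w = 1"
    using assms(2) power_eq_1_iff[of "cmod w" m] by auto
  hence "w * cnj w = 1"
    by (simp add: complex_norm_square[symmetric])
  moreover have "w * w ^ (m - 1) = 1"
    using assms by (metis power_eq_if less_not_refl)
  ultimately show ?thesis
    by (metis mult_cancel_left mult_zero_left zero_neq_one)
qed

lemma cnj_poly_real:
  assumes "poly_over S p" "S \<subseteq> \<real>"
  shows "cnj (poly p x) = poly p (cnj x)"
proof -
  have "cnj (coeff p i) = coeff p i" for i
    using assms by (auto simp: poly_over_def Reals_cnj_iff)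
  thus ?thesis
    by (simp add: poly_altdef)
qed

lemma odd_power_real_inj:
  assumes "x \<in> \<real>" "y \<in> \<real>" "odd n" "x ^ n = (y::complex) ^ n"
  shows "x = y"
proof -
  obtain a b where ab: "x = of_real a" "y = of_real b"
    using assms by (auto elim!: Reals_cases)
  hence "a ^ n = b ^ n"
    using assms(4) by (metis of_real_eq_iff of_real_power)
  hence "a = b"
    using assms(3) by (metis odd_real_root_power_cancel)
  thus ?thesis by (simp add: ab)
qed

lemma cyclotomic_mono: "S \<subseteq> T \<Longrightarrow> cyclotomic S \<subseteq> cyclotomic T"
  unfolding cyclotomic_def using poly_over_mono[of S T] by blast

context
  fixes S assumes S: "complex_subfield S"
begin

lemma cyclotomic_common:
  assumes "x \<in> cyclotomic S" "y \<in> cyclotomic S"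
  obtains z where "complex_subfield (adjoin S z)" "adjoin S z \<subseteq> cyclotomic S"
    "x \<in> adjoin S z" "y \<in> adjoin S z"
proof -
  obtain p w m where p: "x = poly p w" "poly_over S p" "m > 0" "w ^ m = 1"
    using assms(1) by (auto simp: cyclotomic_def)
  obtain q v n where q: "y = poly q v" "poly_over S q" "n > 0" "v ^ n = 1"
    using assms(2) by (auto simp: cyclotomic_def)
  obtain z i j where z: "z ^ (m * n) = 1" "w = z ^ i" "v = z ^ j"
    using common_root_of_unity p q by metis
  have mem: "poly g (z ^ k) \<in> adjoin S z" if "poly_over S g" for g k
    unfolding adjoin_def using that
    by (auto intro!: exI[of _ "pcompose g (monom 1 k)"] poly_over_pcompose[OF S]
         poly_over_monom[OF S] csf_1[OF S] simp: poly_pcompose poly_monom)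
  show ?thesis
  proof (rule that[of z])
    show "complex_subfield (adjoin S z)"
      by (rule adjoin_radical_subfield[OF S, of "m * n"]) (use z p q csf_1[OF S] in auto)
    show "adjoin S z \<subseteq> cyclotomic S"
      unfolding adjoin_def cyclotomic_def using z(1) p(3) q(3) nat_0_less_mult_iff by blast
  qed (use mem p q z in auto)
qed

lemma subset_cyclotomic: "S \<subseteq> cyclotomic S"
proof
  fix x assume "x \<in> S"
  moreover have "x = poly [:x:] 1" "(1::complex) ^ 1 = 1" by simp_all
  ultimately show "x \<in> cyclotomic S"
    unfolding cyclotomic_def using poly_over_const[OF S] zero_less_one by blast
qed

lemma root_of_unity_cyclotomic: "w ^ m = 1 \<Longrightarrow> m > 0 \<Longrightarrow> w \<in> cyclotomic S"
  unfolding cyclotomic_def using poly_over_pCons[OF S csf_0[OF S] poly_over_1[OF S]]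
  by (auto intro!: exI[of _ "[:0,1:]"] simp: one_pCons)

lemma cyclotomic_subfield: "complex_subfield (cyclotomic S)"
  unfolding complex_subfield_def
proof (intro conjI ballI)
  show "1 \<in> cyclotomic S"
    using subset_cyclotomic csf_1[OF S] by blast
next
  fix x assume "x \<in> cyclotomic S"
  thus "inverse x \<in> cyclotomic S"
    using cyclotomic_common[of x x] csf_inverse by (metis in_mono)
next
  fix x y assume "x \<in> cyclotomic S" "y \<in> cyclotomic S"
  then obtain z where z: "complex_subfield (adjoin S z)" "adjoin S z \<subseteq> cyclotomic S"
    "x \<in> adjoin S z" "y \<in> adjoin S z"
    using cyclotomic_common by metis
  thus "x - y \<in> cyclotomic S" "x * y \<in> cyclotomic S"
    using csf_diff[OF z(1)] csf_mult[OF z(1)] by blast+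
qed

text \<open>
  Complex conjugation permutes the roots of unity and fixes a real ground field.
\<close>

lemma cyclotomic_cnj:
  assumes "S \<subseteq> \<real>" "x \<in> cyclotomic S"
  shows "cnj x \<in> cyclotomic S"
proof -
  obtain p w m where p: "x = poly p w" "poly_over S p" "m > 0" "w ^ m = 1"
    using assms(2) by (auto simp: cyclotomic_def)
  have "cnj x = poly p (cnj w)"
    unfolding p(1) by (rule cnj_poly_real[OF p(2) assms(1)])
  moreover have "cnj w ^ m = 1"
    using p(4) by (metis complex_cnj_one complex_cnj_power)
  ultimately show ?thesis
    using p by (auto simp: cyclotomic_def)
qed

text \<open>
  Roots of unity may be adjoined before the radical, so that elements become polynomials
  in the radical to which Kummer theory applies.
\<close>

lemma cyclotomic_adjoin_subset:
  assumes "n > 0" "x ^ n \<in> S"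
  shows "cyclotomic (adjoin S x) \<subseteq> adjoin (cyclotomic S) x"
proof
  have Z: "complex_subfield (adjoin (cyclotomic S) x)"
    using adjoin_radical_subfield[OF cyclotomic_subfield assms(1)] assms(2) subset_cyclotomic by blast
  fix y assume "y \<in> cyclotomic (adjoin S x)"
  then obtain p w m where p: "y = poly p w" "poly_over (adjoin S x) p" "m > 0" "w ^ m = 1"
    by (auto simp: cyclotomic_def)
  have "w \<in> adjoin (cyclotomic S) x"
    using root_of_unity_cyclotomic[OF p(4,3)] subset_adjoin[OF cyclotomic_subfield] by blast
  moreover have "poly_over (adjoin (cyclotomic S) x) p"
    using p(2) poly_over_mono[OF adjoin_mono[OF subset_cyclotomic]] by blast
  ultimately show "y \<in> adjoin (cyclotomic S) x"
    unfolding p(1) by (intro poly_mem[OF Z])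
qed

end

lemma poly_root_dvd: "f dvd g \<Longrightarrow> poly f x = 0 \<Longrightarrow> poly g x = (0::complex)"
  by (auto elim!: dvdE)

section \<open>Real radicals and roots of unity\<close>

text \<open>
  \<open>X ^ m - 1\<close> has \<open>m\<close> distinct roots, which leaves no room for a multiple root of a
  factor.
\<close>

lemma card_roots_squarefree:
  fixes f :: "complex poly"
  assumes "f dvd monom 1 m - [:1:]" "m > 0"
  shows "card {x. poly f x = 0} = degree f"
proof -
  obtain g where g: "monom 1 m - [:1:] = f * g"
    using assms(1) by (auto elim: dvdE)
  have nz: "f \<noteq> 0" "g \<noteq> 0"
    using g radical_nonzero[OF assms(2), of 1] by auto
  have "{x::complex. x ^ m = 1} = {x. poly f x = 0} \<union> {x. poly g x = 0}"
  proof -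
    have "x ^ m = 1 \<longleftrightarrow> poly (f * g) x = 0" for x
      unfolding g[symmetric] by (simp add: poly_monom)
    thus ?thesis by auto
  qed
  hence "m \<le> card {x. poly f x = 0} + card {x. poly g x = 0}"
    by (metis card_Un_le card_roots_unity_eq assms(2))
  also have "card {x. poly g x = 0} \<le> degree g"
    by (rule card_poly_roots_bound[OF nz(2)])
  finally have "m \<le> card {x. poly f x = 0} + degree g" by simp
  moreover have "m = degree f + degree g"
    using degree_mult_eq[OF nz] degree_radical[OF assms(2), of 1] by (simp add: g)
  ultimately show ?thesis
    using card_poly_roots_bound[OF nz(1)] by linarith
qed

text \<open>
  A cyclotomic extension of a real field contains no new real radical of odd exponent. The
  idea is that all conjugates of a real element \<open>d\<close> of such an abelian extension are real,
  whereas the only real \<open>q\<close>-th root of \<open>d ^ q\<close> is \<open>d\<close> itself, so \<open>d\<close> has no conjugate but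
  itself.

  Concretely, \<open>d\<close> is the value at a root of unity \<open>w\<close> of a polynomial over \<open>T\<close>, which
  after averaging with its conjugate takes real values at all roots of unity of the same
  order. Its remainder modulo the minimal polynomial \<open>f\<close> of \<open>w\<close> then takes the value \<open>d\<close>
  at each of the \<open>degree f\<close> roots of \<open>f\<close>, hence is constant.
\<close>

lemma real_radical_in_cyclotomic:
  assumes T: "complex_subfield T" "T \<subseteq> \<real>" and d: "d \<in> \<real>" "odd q" "d ^ q \<in> T" "d \<in> cyclotomic T"
  shows "d \<in> T"
proof -
  obtain p w m where p: "d = poly p w" "poly_over T p" "m > 0" "w ^ m = 1"
    using d(4) by (auto simp: cyclotomic_def)
  (* On roots of unity of order dividing m, the power v ^ (m - 1) is the complex conjugate of
     v. *)
  define D where "D = Polynomial.smult (1/2) (p + pcompose p (monom 1 (m - 1)))"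
  have "1 / of_nat 2 \<in> T"
    by (intro csf_divide[OF T(1)] csf_1[OF T(1)] csf_of_nat[OF T(1)])
  hence D: "poly_over T D"
    unfolding D_def using p(2)
    by (intro poly_over_smult[OF T(1)] poly_over_add[OF T(1)] poly_over_pcompose[OF T(1)]
        poly_over_monom[OF T(1)] csf_1[OF T(1)]) auto
  have D_Re: "poly D v = of_real (Re (poly p v))" if "v ^ m = 1" for v
    using cnj_poly_real[OF p(2) T(2), of v] cnj_root_of_unity[OF that p(3)]
    by (simp add: D_def poly_pcompose poly_monom complex_eq_iff)
  have Dw: "poly D w = d"
    using D_Re[OF p(4)] d(1) by (simp add: p(1))
  obtain f where f: "poly_over T f" "lead_coeff f = 1" "poly f w = 0" "degree f > 0"
    and dvd: "\<And>g. poly_over T g \<Longrightarrow> poly g w = 0 \<Longrightarrow> f dvd g"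
    using minimal_polynomial[OF T(1) poly_over_radical[OF T(1) csf_1[OF T(1)], of m]
        radical_nonzero[OF p(3)], of w] p(4) by (metis cancel_comm_monoid_add_class.diff_cancel poly_radical)
  have f_dvd: "f dvd monom 1 m - [:1:]"
    by (rule dvd[OF poly_over_radical[OF T(1) csf_1[OF T(1)]]]) (simp add: p(4) poly_monom)
  have "f dvd D ^ q - [:d ^ q:]"
    using D d(3) by (intro dvd poly_over_diff[OF T(1)] poly_over_power[OF T(1)] poly_over_const[OF T(1)])
      (simp_all add: Dw)
  have root: "poly D v = d" if "poly f v = 0" for v
  proof -
    have "poly (monom 1 m - [:1:]) v = 0"
      using f_dvd that by (rule poly_root_dvd)
    hence "v ^ m = 1" by (simp add: poly_monom)
    hence "poly D v \<in> \<real>" using D_Re by simp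
    moreover have "poly (D ^ q - [:d ^ q:]) v = 0"
      using \<open>f dvd D ^ q - _\<close> that by (rule poly_root_dvd)
    ultimately show ?thesis
      using d odd_power_real_inj by simp
  qed
  have "f \<noteq> 0" using f(4) by auto
  obtain h r where hr: "poly_over T r" "D = h * f + r" "r = 0 \<or> degree r < degree f"
    using poly_over_division[OF T(1) f(1) \<open>f \<noteq> 0\<close> D] by blast
  have "r - [:d:] = 0"
  proof (rule ccontr)
    assume nz: "r - [:d:] \<noteq> 0"
    have "{v. poly f v = 0} \<subseteq> {v. poly (r - [:d:]) v = 0}"
      using root hr(2) by auto
    hence "degree f \<le> card {v. poly (r - [:d:]) v = 0}"
      unfolding card_roots_squarefree[OF f_dvd p(3), symmetric]
      by (intro card_mono poly_roots_finite nz)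
    also have "\<dots> \<le> degree (r - [:d:])"
      by (rule card_poly_roots_bound[OF nz])
    also have "\<dots> < degree f"
      using hr(3) f(4) by (intro degree_diff_less) auto
    finally show False by simp
  qed
  hence "coeff r 0 = d" by simp
  thus ?thesis
    using hr(1) by (auto simp: poly_over_def)
qed

text \<open>
  Each conjugate of a radical \<open>d\<close> is \<open>d\<close> times a root of unity, and so a product of \<open>e\<close>
  conjugates is \<open>d ^ e\<close> times a root of unity. This controls the constant coefficients of
  the factors of \<open>X ^ q - d ^ q\<close>.
\<close>

lemma prod_mset_radical_conjugates:
  fixes d :: complex
  assumes "\<And>x. x \<in># A \<Longrightarrow> x ^ q = d ^ q" "d \<noteq> 0"
  shows "\<exists>w. w ^ q = 1 \<and> (\<Prod>x\<in>#A. - x) = (-1) ^ size A * w * d ^ size A"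
  using assms(1)
proof (induction A)
  case empty
  show ?case by (intro exI[of _ 1]) simp
next
  case (add x A)
  then obtain w where w: "w ^ q = 1" "(\<Prod>x\<in>#A. - x) = (-1) ^ size A * w * d ^ size A"
    by auto
  have "(w * (x / d)) ^ q = 1"
    using w(1) add.prems[of x] assms(2) by (simp add: power_mult_distrib power_divide)
  moreover have "(\<Prod>x\<in>#add_mset x A. - x) =
      (-1) ^ size (add_mset x A) * (w * (x / d)) * d ^ size (add_mset x A)"
    using w(2) assms(2) by simp
  ultimately show ?case by blast
qed

text \<open>
  \<open>X ^ q - d ^ q\<close> is irreducible over a field that contains the \<open>q\<close>-th roots of unity but
  not \<open>d\<close>: the constant coefficient of a factor of degree \<open>e\<close> puts \<open>d ^ e\<close> into the field,
  and for \<open>0 < e < q\<close> the exponents \<open>e\<close> and \<open>q\<close> are coprime.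
\<close>

lemma kummer_dvd:
  assumes Z: "complex_subfield Z" and roots: "\<And>w. w ^ q = 1 \<Longrightarrow> w \<in> Z"
    and q: "prime q" and d: "d ^ q \<in> Z" "d \<notin> Z" and g: "poly_over Z g" "poly g d = 0"
  shows "monom 1 q - [:d ^ q:] dvd g"
proof -
  have q0: "q > 0" using q by (rule prime_gt_0_nat)
  have d0: "d \<noteq> 0" using d(2) csf_0[OF Z] by auto
  obtain f where f: "poly_over Z f" "lead_coeff f = 1" "poly f d = 0" "degree f > 0"
    and dvd: "\<And>g. poly_over Z g \<Longrightarrow> poly g d = 0 \<Longrightarrow> f dvd g"
    using minimal_polynomial[OF Z poly_over_radical[OF Z d(1), of q] radical_nonzero[OF q0], of d]
    by (metis cancel_comm_monoid_add_class.diff_cancel poly_radical)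
  have f_dvd: "f dvd monom 1 q - [:d ^ q:]"
    by (rule dvd[OF poly_over_radical[OF Z d(1)]]) (simp add: poly_monom)
  then obtain k where k: "monom 1 q - [:d ^ q:] = f * k"
    by (auto elim: dvdE)
  have nz: "f \<noteq> 0" "k \<noteq> 0"
    using k radical_nonzero[OF q0, of "d ^ q"] by auto
  have deg: "q = degree f + degree k"
    using degree_mult_eq[OF nz] degree_radical[OF q0, of "d ^ q"] by (simp add: k)
  obtain A where A: "size A = degree f" "f = (\<Prod>x\<in>#A. [:- x, 1:])"
    using alg_closed_imp_factorization[OF nz(1)] f(2) by auto
  have conj: "x ^ q = d ^ q" if "x \<in># A" for x
  proof -
    have "poly f x = 0"
      unfolding A(2) poly_prod_mset using that by (auto simp: prod_mset_zero_iff intro!: image_eqI[of _ _ x])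
    hence "poly (monom 1 q - [:d ^ q:]) x = 0"
      using f_dvd poly_root_dvd by blast
    thus ?thesis by (simp add: poly_monom)
  qed
  obtain w where w: "w ^ q = 1" "(\<Prod>x\<in>#A. - x) = (-1) ^ size A * w * d ^ size A"
    using prod_mset_radical_conjugates[OF conj d0] by blast
  have "poly f 0 = (\<Prod>x\<in>#A. - x)"
    unfolding A(2) poly_prod_mset by (simp add: multiset.map_comp comp_def)
  hence const: "d ^ degree f = poly f 0 / ((-1) ^ size A * w)"
    using w A(1) q0 by (auto simp: power_0_left)
  have "poly f 0 \<in> Z"
    using poly_mem[OF Z f(1) csf_0[OF Z]] .
  hence "d ^ degree f \<in> Z"
    unfolding const using roots[OF w(1)]
    by (intro csf_divide[OF Z] csf_mult[OF Z] csf_power[OF Z] csf_uminus[OF Z] csf_1[OF Z])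
  have "degree f = q"
  proof (rule ccontr)
    assume "degree f \<noteq> q"
    hence "degree f < q" using deg by simp
    hence "coprime (degree f) q"
      using q f(4) by (metis coprime_commute nat_dvd_not_less prime_imp_coprime)
    hence "d \<in> Z"
      using coprime_powers_mem[OF Z \<open>d ^ degree f \<in> Z\<close> d(1)] by blast
    thus False using d(2) by simp
  qed
  hence "degree k = 0" using deg by simp
  then obtain c where c: "k = [:c:]"
    using degree_eq_zeroE by blast
  have "f dvd g" using dvd g by blast
  hence "Polynomial.smult c f dvd g"
    using c nz(2) by (simp add: smult_dvd)
  thus ?thesis
    by (simp add: k c)
qed

text \<open>
  The substitute for Galois automorphisms. The first statement says that \<open>d \<mapsto> w d\<close> extends
  to an automorphism over the field with all roots of unity: algebraic relations for \<open>d\<close>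
  also hold for \<open>w d\<close>. The second one is the independence of \<open>1, d, \<dots>, d ^ (q - 1)\<close>.
\<close>

lemma
  assumes T: "complex_subfield T" "T \<subseteq> \<real>"
    and d: "d \<in> \<real>" "d ^ q \<in> T" "d \<notin> T" and q: "prime q" "odd q"
    and g: "poly_over (cyclotomic T) g" "poly g d = 0"
  shows kummer_cyclotomic_conjugate: "w ^ q = 1 \<Longrightarrow> poly g (w * d) = 0"
    and kummer_cyclotomic_independent: "degree g < q \<Longrightarrow> g = 0"
proof -
  have "d \<notin> cyclotomic T"
    using real_radical_in_cyclotomic[OF T d(1) q(2) d(2)] d(3) by blast
  moreover have "d ^ q \<in> cyclotomic T"
    using d(2) subset_cyclotomic[OF T(1)] by blast
  ultimately have dvd: "monom 1 q - [:d ^ q:] dvd g"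
    using root_of_unity_cyclotomic[OF T(1)] prime_gt_0_nat[OF q(1)]
    by (intro kummer_dvd[OF cyclotomic_subfield[OF T(1)] _ q(1)] g) auto
  show "poly g (w * d) = 0" if "w ^ q = 1"
    using dvd by (rule poly_root_dvd) (simp add: that poly_monom power_mult_distrib)
  show "g = 0" if "degree g < q"
    using dvd that degree_radical[OF prime_gt_0_nat[OF q(1)], of "d ^ q"]
    by (metis dvd_imp_degree_le not_le)
qed

lemma adjoin_real:
  assumes "S \<subseteq> \<real>" "x \<in> \<real>"
  shows "adjoin S x \<subseteq> \<real>"
proof (rule adjoin_subset[OF _ assms])
  show "complex_subfield \<real>"
    by (auto simp: complex_subfield_def)
qed

text \<open>
  Adjoining a \<open>q\<close>-th root \<open>d\<close> is an extension of prime degree, so any new element \<open>y\<close> of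
  it generates \<open>d\<close>. If \<open>d\<close> were not in a real field \<open>U\<close> that contains \<open>y\<close>, then writing
  \<open>y\<close> as a polynomial in \<open>d\<close> would be a linear relation over \<open>U\<close> between powers of \<open>d\<close>.
\<close>

lemma adjoin_exchange:
  assumes T: "complex_subfield T" and U: "complex_subfield U" "U \<subseteq> \<real>" "T \<subseteq> U"
    and d: "d \<in> \<real>" "d ^ q \<in> T" and q: "prime q" "odd q"
    and y: "y \<in> adjoin T d" "y \<in> U" "y \<notin> T"
  shows "d \<in> U"
proof (rule ccontr)
  assume nd: "d \<notin> U"
  have q0: "q > 0" using q prime_gt_0_nat by blast
  obtain g where g: "poly_over T g" "degree g < q" "y = poly g d"
    using adjoin_radical_reduced[OF T q0 d(2) y(1)] by blast
  have "g - [:y:] = 0"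
  proof (rule kummer_cyclotomic_independent[OF U(1,2) d(1) _ nd q])
    show "d ^ q \<in> U"
      using d(2) U(3) by blast
    show "poly_over (cyclotomic U) (g - [:y:])"
      using poly_over_mono[OF U(3) g(1)] y(2)
      by (intro poly_over_mono[OF subset_cyclotomic[OF U(1)]] poly_over_diff[OF U(1)] poly_over_const[OF U(1)])
    show "poly (g - [:y:]) d = 0" using g(3) by simp
    show "degree (g - [:y:]) < q"
      using g(2) q0 by (intro degree_diff_less) auto
  qed
  hence "y = coeff g 0" by simp
  thus False
    using g(1) y(3) by (auto simp: poly_over_def)
qed

section \<open>Towers of real radicals of odd prime degree\<close>

definition real_subfield :: "complex set \<Rightarrow> bool" where
  "real_subfield S \<longleftrightarrow> complex_subfield S \<and> S \<subseteq> \<real>"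

lemma real_subfieldD: "real_subfield S \<Longrightarrow> complex_subfield S" "real_subfield S \<Longrightarrow> S \<subseteq> \<real>"
  by (auto simp: real_subfield_def)

lemma real_subfield_adjoin:
  assumes "real_subfield S" "d \<in> \<real>" "d ^ q \<in> S" "prime q"
  shows "real_subfield (adjoin S d)"
  using assms adjoin_real adjoin_radical_subfield[of S q d] prime_gt_0_nat[of q]
  by (auto simp: real_subfield_def)

text \<open>
  The number \<open>n\<close> only bounds the number of steps, and steps may be trivial; an exact count
  would not be inherited by intermediate fields.
\<close>

inductive radical_tower :: "nat \<Rightarrow> complex set \<Rightarrow> complex set \<Rightarrow> bool" where
  trivial: "radical_tower n S S"
| step: "\<lbrakk>d \<in> \<real>; prime q; odd q; d ^ q \<in> S; radical_tower n (adjoin S d) T\<rbrakk>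
    \<Longrightarrow> radical_tower (Suc n) S T"

lemma radical_tower_real:
  assumes "radical_tower n S T" "real_subfield S"
  shows "real_subfield T" "S \<subseteq> T"
proof -
  have "real_subfield T \<and> S \<subseteq> T"
    using assms
  proof induction
    case (step d q S n T)
    thus ?case
      using real_subfield_adjoin[of S d q] subset_adjoin[OF real_subfieldD(1), of S d] by blast
  qed auto
  thus "real_subfield T" "S \<subseteq> T" by auto
qed

lemma radical_tower_nontrivial:
  assumes "radical_tower n S T" "real_subfield S" "S \<noteq> T"
  obtains b l where "b \<in> T" "b \<notin> S" "prime l" "odd l" "b ^ l \<in> S"
proof -
  have "\<exists>b l. b \<in> T \<and> b \<notin> S \<and> prime l \<and> odd l \<and> b ^ l \<in> S"
    using assms
  proof induction
    case (step d q S n T)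
    show ?case
    proof (cases "d \<in> S")
      case True
      hence "adjoin S d = S"
        using step.prems(1) by (simp add: real_subfieldD adjoin_mem_eq)
      thus ?thesis using step by simp
    next
      case False
      have "d \<in> adjoin S d"
        using step.prems(1) by (simp add: real_subfieldD mem_adjoin)
      moreover have "adjoin S d \<subseteq> T"
        using radical_tower_real(2)[OF step.hyps(5)] real_subfield_adjoin step by blast
      ultimately show ?thesis
        using False step.hyps by blast
    qed
  qed auto
  thus ?thesis using that by blast
qed

text \<open>
  Extends \<open>real_radical_in_cyclotomic\<close> from radicals to all elements of a tower. In a
  single step, an element outside the ground field generates the radical by
  \<open>adjoin_exchange\<close>, so the radical would lie in the cyclotomic extension as well.
\<close>

lemma radical_tower_inter_cyclotomic:
  assumes "radical_tower n S T" "real_subfield S" "y \<in> T" "y \<in> cyclotomic S"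
  shows "y \<in> S"
  using assms
proof induction
  case (step d q S n T)
  have S: "complex_subfield S" "S \<subseteq> \<real>"
    using step.prems(1) by (auto simp: real_subfield_def)
  have S': "real_subfield (adjoin S d)"
    using real_subfield_adjoin step by blast
  have y: "y \<in> adjoin S d"
    using step.IH[OF S'] step.prems cyclotomic_mono[OF subset_adjoin[OF S(1)]] by blast
  show ?case
  proof (rule ccontr)
    assume "y \<notin> S"
    have Z: "complex_subfield (cyclotomic S)"
      by (rule cyclotomic_subfield[OF S(1)])
    (* The exchange property needs a real field, hence the intersection with the reals. *)
    have "complex_subfield (cyclotomic S \<inter> \<real>)"
      unfolding complex_subfield_def
      by (auto intro: csf_1[OF Z] csf_diff[OF Z] csf_mult[OF Z] csf_inverse[OF Z])
    moreover have "S \<subseteq> cyclotomic S \<inter> \<real>"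
      using S subset_cyclotomic[OF S(1)] by blast
    moreover have "y \<in> cyclotomic S \<inter> \<real>"
      using step.prems y real_subfieldD(2)[OF S'] by blast
    ultimately have "d \<in> cyclotomic S \<inter> \<real>"
      using adjoin_exchange[OF S(1), of "cyclotomic S \<inter> \<real>" d q y] step.hyps y \<open>y \<notin> S\<close> by blast
    hence "d \<in> S"
      using real_radical_in_cyclotomic[OF S] step.hyps by blast
    hence "adjoin S d = S"
      using S(1) adjoin_mem_eq by blast
    thus False using y \<open>y \<notin> S\<close> by simp
  qed
qed auto

section \<open>Elements of modulus one\<close>

lemma primitive_root_of_unity:
  assumes "q > 0"
  obtains w :: complex where "w ^ q = 1" "\<And>i j. i < q \<Longrightarrow> j < q \<Longrightarrow> w ^ i = w ^ j \<Longrightarrow> i = j"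
proof -
  have "cis (2 * pi * real k / real q) = cis (2 * pi / real q) ^ k" for k
    by (simp add: DeMoivre field_simps)
  hence "inj_on (\<lambda>k. cis (2 * pi / real q) ^ k) {..<q}"
    using bij_betw_roots_unity[OF assms] by (simp add: bij_betw_def)
  moreover have "cis (2 * pi / real q) ^ q = 1"
    using assms by (simp add: DeMoivre)
  ultimately show ?thesis
    using that[of "cis (2 * pi / real q)"] by (auto simp: inj_on_def)
qed

lemma degree_pcompose_scale_le: "degree (pcompose p [:0, c:]) \<le> degree (p :: complex poly)"
  using degree_pcompose_le[of p "[:0, c:]"] by (auto split: if_splits)

text \<open>
  This is where real radicals differ from arbitrary ones. Let \<open>Z\<close> be \<open>S\<close> with all roots of
  unity. By Kummer theory, an element \<open>x\<close> of \<open>Z(d)\<close> with a power in \<open>Z\<close> has the form \<open>c d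
  ^ i\<close> with \<open>c\<close> in \<open>Z\<close> and \<open>i < q\<close>. As \<open>d\<close> is real, \<open>\<bar>x\<bar> = 1\<close> means that \<open>d ^ (2 i)\<close> is in
  \<open>Z\<close>, and since \<open>q\<close> is odd this forces \<open>i = 0\<close>.
\<close>

lemma unit_radical_cyclotomic:
  assumes S: "real_subfield S" and d: "d \<in> \<real>" "d ^ q \<in> S" and q: "prime q" "odd q"
    and x: "x \<in> cyclotomic (adjoin S d)" "cmod x = 1" "l > 0" "x ^ l \<in> cyclotomic S"
  shows "x \<in> cyclotomic S"
proof (cases "d \<in> S")
  case True
  thus ?thesis
    using adjoin_mem_eq[OF real_subfieldD(1)[OF S]] x(1) by simp
next
  case False
  define Z where "Z = cyclotomic S"
  have S': "complex_subfield S" "S \<subseteq> \<real>"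
    using S by (auto simp: real_subfield_def)
  have Z: "complex_subfield Z"
    unfolding Z_def by (rule cyclotomic_subfield[OF S'(1)])
  note kummer = kummer_cyclotomic_conjugate[OF S' d False q, folded Z_def]
    kummer_cyclotomic_independent[OF S' d False q, folded Z_def]
  have q0: "q > 0" using q prime_gt_0_nat by blast
  have dZ: "d \<notin> Z" "d ^ q \<in> Z"
    using real_radical_in_cyclotomic[OF S' d(1) q(2) d(2)] False d(2) subset_cyclotomic[OF S'(1)]
    by (auto simp: Z_def)
  have "x \<in> adjoin Z d"
    using cyclotomic_adjoin_subset[OF S'(1) q0 d(2)] x(1) by (auto simp: Z_def)
  then obtain g where g: "poly_over Z g" "degree g < q" "x = poly g d"
    using adjoin_radical_reduced[OF Z q0 dZ(2)] by blast
  obtain w :: complex where w: "w ^ q = 1" "\<And>i j. i < q \<Longrightarrow> j < q \<Longrightarrow> w ^ i = w ^ j \<Longrightarrow> i = j"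
    using primitive_root_of_unity[OF q0] by blast
  have wZ: "w \<in> Z"
    using root_of_unity_cyclotomic[OF S'(1) w(1) q0] by (simp add: Z_def)
  have x0: "x \<noteq> 0" using x(2) by auto
  (* The conjugate of x under d -> w d is e x, and e is a root of unity as x is a radical. *)
  define e where "e = poly g (w * d) / x"
  have "poly (g ^ l - [:x ^ l:]) (w * d) = 0"
    using x(4) g(3) by (intro kummer(1) w(1) poly_over_diff[OF Z] poly_over_power[OF Z]
        poly_over_const[OF Z] g(1)) (auto simp: Z_def)
  hence "e ^ l = 1"
    using x0 by (simp add: e_def power_divide)
  hence eZ: "e \<in> Z"
    using root_of_unity_cyclotomic[OF S'(1) _ x(3)] by (simp add: Z_def)
  (* Comparing coefficients of x and its conjugate, w ^ i = e for each exponent i that occurs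
     in g, and the powers of w are distinct: g is a monomial. *)
  have "pcompose g [:0, w:] - Polynomial.smult e g = 0"
  proof (rule kummer(2))
    show "poly_over Z (pcompose g [:0, w:] - Polynomial.smult e g)"
      using g(1) wZ eZ
      by (intro poly_over_diff[OF Z] poly_over_pcompose[OF Z] poly_over_smult[OF Z]
          poly_over_pCons[OF Z] poly_over_0[OF Z] csf_0[OF Z])
    show "poly (pcompose g [:0, w:] - Polynomial.smult e g) d = 0"
      using g(3) x0 by (simp add: poly_pcompose e_def mult.commute)
    show "degree (pcompose g [:0, w:] - Polynomial.smult e g) < q"
      using g(2) degree_pcompose_scale_le[of g w] degree_smult_le[of e g]
      by (intro degree_diff_less) linarith+
  qed
  hence "coeff (pcompose g [:0, w:]) i = coeff (Polynomial.smult e g) i" for i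
    by simp
  hence "coeff g i * w ^ i = coeff g i * e" for i
    by (simp add: coeff_pcompose_linear mult.commute)
  hence eq: "w ^ i = e" if "coeff g i \<noteq> 0" for i
    using that mult_left_cancel by blast
  define i where "i = degree g"
  have "g \<noteq> 0" using g(3) x0 by auto
  hence gi: "coeff g i \<noteq> 0" by (simp add: i_def)
  have "coeff g j = 0" if "j \<noteq> i" for j
  proof (rule ccontr)
    assume j: "coeff g j \<noteq> 0"
    hence "j < q"
      using g(2) le_degree[OF j] by simp
    thus False
      using w(2)[of j i] g(2) that eq[OF j] eq[OF gi] by (simp add: i_def)
  qed
  hence "g = monom (coeff g i) i"
    by (intro poly_eqI) auto
  hence xi: "x = coeff g i * d ^ i"
    unfolding g(3) by (metis poly_monom)
  have giZ: "coeff g i \<in> Z" using g(1) by (simp add: poly_over_def)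
  show ?thesis
  proof (cases "i = 0")
    case True
    thus ?thesis using xi giZ by (simp add: Z_def)
  next
    case False
    have "x * cnj x = 1"
      using x(2) by (simp add: complex_norm_square[symmetric])
    moreover have "cnj d = d"
      using d(1) by (simp add: Reals_cnj_iff)
    ultimately have "coeff g i * cnj (coeff g i) * d ^ (2 * i) = 1"
      unfolding xi by (simp add: mult_ac power_mult power2_eq_square power_mult_distrib)
    hence "d ^ (2 * i) = inverse (coeff g i * cnj (coeff g i))"
      by (metis inverse_unique)
    also have "\<dots> \<in> Z"
      using giZ cyclotomic_cnj[OF S'(1,2)] by (intro csf_inverse[OF Z] csf_mult[OF Z]) (auto simp: Z_def)
    finally have "d ^ (2 * i) \<in> Z" .
    moreover have "coprime (2 * i) q"
    proof -
      have "\<not> q dvd i" using False g(2) by (auto simp: i_def dest: dvd_imp_le)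
      hence "coprime i q" using q(1) by (metis coprime_commute prime_imp_coprime)
      thus ?thesis using q(2) by simp
    qed
    ultimately show ?thesis
      using coprime_powers_mem[OF Z _ dZ(2)] dZ(1) by blast
  qed
qed

lemma radical_tower_unit_cyclotomic:
  assumes "radical_tower n S T" "real_subfield S"
    and "x \<in> cyclotomic T" "cmod x = 1" "l > 0" "x ^ l \<in> cyclotomic S"
  shows "x \<in> cyclotomic S"
  using assms
proof induction
  case (step d q S n T)
  have "x \<in> cyclotomic (adjoin S d)"
    using step cyclotomic_mono[OF subset_adjoin[OF real_subfieldD(1)[OF step.prems(1)]], of d]
      real_subfield_adjoin[of S d q] by blast
  thus ?case
    using unit_radical_cyclotomic[of S d q x l] step by blast
qed auto

section \<open>Intermediate fields of a tower of real radicals\<close>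

text \<open>
  Discrete Fourier inversion: the sum of \<open>w ^ (j (m - i))\<close> over \<open>j < q\<close> is \<open>q\<close> for \<open>m = i\<close>
  and vanishes for all other \<open>m < q\<close>.
\<close>

lemma coeff_from_conjugates:
  fixes g :: "complex poly"
  assumes "degree g < q" "i < q" and w: "w ^ q = 1"
    "\<And>i j. i < q \<Longrightarrow> j < q \<Longrightarrow> w ^ i = w ^ j \<Longrightarrow> i = j"
  shows "of_nat q * coeff g i * x ^ i = (\<Sum>j<q. cnj (w ^ j) ^ i * poly g (w ^ j * x))"
proof -
  have q0: "q > 0" using assms(2) by simp
  have "w \<noteq> 0"
  proof
    assume "w = 0"
    thus False using w(1) q0 by (simp add: power_0_left)
  qed
  have cw: "cnj w = inverse w"
    using cnj_root_of_unity[OF w(1) q0] w(1) \<open>w \<noteq> 0\<close> q0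
    by (simp add: power_diff inverse_eq_divide)
  have sum_zeta: "(\<Sum>j<q. (w ^ m / w ^ i) ^ j) = (if m = i then of_nat q else 0)" if "m < q" for m
  proof (cases "m = i")
    case True
    thus ?thesis using \<open>w \<noteq> 0\<close> by simp
  next
    case False
    hence "w ^ m / w ^ i \<noteq> 1"
      using w(2)[of m i] that assms(2) \<open>w \<noteq> 0\<close> by auto
    moreover have "(w ^ m / w ^ i) ^ q = 1"
      using w(1) by (metis div_by_1 mult.commute power_divide power_mult power_one)
    ultimately show ?thesis
      using False by (simp add: geometric_sum)
  qed
  have poly: "poly g y = (\<Sum>m<q. coeff g m * y ^ m)" for y
    unfolding poly_altdef using assms(1)
    by (intro sum.mono_neutral_left) (auto simp: coeff_eq_0)
  have "(\<Sum>j<q. cnj (w ^ j) ^ i * poly g (w ^ j * x))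
      = (\<Sum>j<q. \<Sum>m<q. coeff g m * x ^ m * (w ^ m / w ^ i) ^ j)"
    unfolding poly sum_distrib_left
  proof (rule sum.cong[OF refl], rule sum.cong[OF refl])
    fix j m
    have "cnj (w ^ j) ^ i = inverse ((w ^ i) ^ j)"
      by (simp add: cw power_inverse mult.commute flip: power_mult)
    moreover have "(w ^ j * x) ^ m = (w ^ m) ^ j * x ^ m"
      by (simp add: power_mult_distrib mult.commute flip: power_mult)
    moreover have "(w ^ m / w ^ i) ^ j = (w ^ m) ^ j * inverse ((w ^ i) ^ j)"
      by (simp add: power_divide) (simp add: divide_inverse)
    ultimately show "cnj (w ^ j) ^ i * (coeff g m * (w ^ j * x) ^ m) =
        coeff g m * x ^ m * (w ^ m / w ^ i) ^ j"
      by (simp only: mult_ac)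
  qed
  also have "\<dots> = (\<Sum>m<q. coeff g m * x ^ m * (\<Sum>j<q. (w ^ m / w ^ i) ^ j))"
    by (subst sum.swap) (simp add: sum_distrib_left)
  also have "\<dots> = (\<Sum>m<q. if m = i then of_nat q * coeff g i * x ^ i else 0)"
    using sum_zeta by (intro sum.cong refl) auto
  also have "\<dots> = of_nat q * coeff g i * x ^ i"
    using assms(2) by simp
  finally show ?thesis ..
qed

text \<open>
  The heart of the proof. Let \<open>F = Q(a)\<close> and let \<open>Z\<close> be \<open>F\<close> with all roots of unity. For a
  \<open>p\<close>-th root of unity \<open>u\<close> let \<open>\<sigma>\<^sub>u\<close> be the automorphism over \<open>K\<close> and the roots of unity
  with \<open>a \<mapsto> u a\<close>. If \<open>b = B(a)\<close> with \<open>B\<close> over \<open>K\<close>, then \<open>\<sigma>\<^sub>u b = B(u a)\<close> is again a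
  radical over \<open>Z\<close>, and its complex conjugate is \<open>\<sigma>\<^sub>v b\<close> for \<open>v\<close> the inverse of \<open>u\<close>. So
  the quotient of \<open>\<sigma>\<^sub>u b\<close> by \<open>\<sigma>\<^sub>v b\<close> has modulus one and a power in \<open>Z\<close>; it is in \<open>Z\<close> by
  \<open>radical_tower_unit_cyclotomic\<close>. Applying \<open>\<sigma>\<^sub>u\<close> to this relation shows that \<open>\<sigma>\<^sub>w b\<close> is
  in \<open>Z b\<close> for \<open>w = u\<^sup>2\<close>, and every \<open>p\<close>-th root of unity is a square.

  Consequently each coefficient of \<open>B\<close>, being up to a factor in \<open>Z\<close> a combination of the
  conjugates of \<open>b\<close>, lies in \<open>Z b\<close>. Its \<open>l\<close>-th power therefore lies in \<open>Z\<close> and in \<open>K\<close>,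
  hence in \<open>Q\<close>. Not all coefficients are in \<open>Q\<close>, since \<open>b\<close> is not in \<open>F\<close>.
\<close>

lemma radical_in_subfield:
  assumes Q: "real_subfield Q" and K: "real_subfield K" "Q \<subseteq> K"
    and a: "a \<in> \<real>" "a ^ p \<in> Q" "a \<notin> K" and p: "prime p" "odd p"
    and tower: "radical_tower n (adjoin Q a) (adjoin K a)"
    and b: "b \<in> adjoin K a" "b \<notin> adjoin Q a" "b ^ l \<in> adjoin Q a" and l: "l > 0"
  obtains c where "c \<in> K" "c \<notin> Q" "c ^ l \<in> Q"
proof -
  define F where "F = adjoin Q a"
  define L where "L = adjoin K a"
  define Z where "Z = cyclotomic F"
  have p0: "p > 0" using p prime_gt_0_nat by blast
  have Q': "complex_subfield Q" "Q \<subseteq> \<real>" and K': "complex_subfield K" "K \<subseteq> \<real>"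
    using Q K by (auto simp: real_subfield_def)
  have aK: "a ^ p \<in> K" using a(2) K(2) by blast
  have F: "real_subfield F" and L: "real_subfield L"
    unfolding F_def L_def using real_subfield_adjoin Q K a aK p(1) by blast+
  have F': "complex_subfield F" "F \<subseteq> \<real>" and L': "complex_subfield L" "L \<subseteq> \<real>"
    using F L by (auto simp: real_subfield_def)
  have QF: "Q \<subseteq> F" and KL: "K \<subseteq> L" and FL: "F \<subseteq> L"
    unfolding F_def L_def using subset_adjoin Q'(1) K'(1) adjoin_mono[OF K(2)] by blast+
  have Z: "complex_subfield Z" and cL: "complex_subfield (cyclotomic L)" and cK: "complex_subfield (cyclotomic K)"
    unfolding Z_def using cyclotomic_subfield F'(1) L'(1) K'(1) by blast+
  have aZ: "a \<in> Z"
    unfolding Z_def F_def using mem_adjoin[OF Q'(1)] subset_cyclotomic F'(1) F_def by blast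
  have a0: "a \<noteq> 0" using a(3) csf_0[OF K'(1)] by auto
  note conjugate = kummer_cyclotomic_conjugate[OF K' a(1) aK a(3) p]
  have root_cK: "u \<in> cyclotomic K" and root_Z: "u \<in> Z" and root_cL: "u \<in> cyclotomic L" if "u ^ p = 1" for u
    using root_of_unity_cyclotomic[OF _ that p0] K'(1) F'(1) L'(1) by (auto simp: Z_def)
  have over_cK: "poly_over (cyclotomic K) g" if "poly_over K g" for g
    using that subset_cyclotomic[OF K'(1)] poly_over_mono by blast
  obtain B where B: "poly_over K B" "degree B < p" "b = poly B a"
    using adjoin_radical_reduced[OF K'(1) p0 aK b(1)] by blast
  obtain G where G: "poly_over Q G" "b ^ l = poly G a"
    using b(3) by (auto simp: adjoin_def)
  have b0: "b \<noteq> 0" using b(2) csf_0[OF F'(1)] by (auto simp: F_def)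
  have pow: "poly B (u * a) ^ l = poly G (u * a)" if u: "u ^ p = 1" for u
  proof -
    have "poly (B ^ l - G) (u * a) = 0"
      using B G K(2) u by (intro conjugate over_cK poly_over_diff[OF K'(1)] poly_over_power[OF K'(1)])
        (auto intro: poly_over_mono)
    thus ?thesis by simp
  qed
  have pow_Z: "poly B (u * a) ^ l \<in> Z" if u: "u ^ p = 1" for u
    unfolding pow[OF u] using G(1) QF subset_cyclotomic[OF F'(1)] root_Z[OF u] aZ
    by (intro poly_mem[OF Z] csf_mult[OF Z]) (auto simp: Z_def intro: poly_over_mono)
  have conj_unit: "cnj u * u = 1" "cnj u ^ p = 1" if u: "u ^ p = 1" for u :: complex
  proof -
    show "cnj u * u = 1"
      using cnj_root_of_unity[OF u p0] u p0 by (metis power_minus_mult)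
    show "cnj u ^ p = 1"
      using u by (metis complex_cnj_one complex_cnj_power)
  qed
  have cnj_B: "cnj (poly B (u * a)) = poly B (cnj u * a)" for u
    using cnj_poly_real[OF B(1) K'(2), of "u * a"] a(1) by (simp add: Reals_cnj_iff)
  have scale: "poly_over (cyclotomic K) (pcompose B [:0, u:])" if "u ^ p = 1" for u
    using over_cK[OF B(1)] root_cK[OF that]
    by (intro poly_over_pcompose[OF cK] poly_over_pCons[OF cK] poly_over_0[OF cK] csf_0[OF cK])
  have conj_nz: "poly B (u * a) \<noteq> 0" if u: "u ^ p = 1" for u
  proof
    assume "poly B (u * a) = 0"
    hence "poly (pcompose B [:0, u:]) (cnj u * a) = 0"
      by (intro conjugate scale u conj_unit(2)) (simp add: poly_pcompose mult.commute)
    moreover have "cnj u * a * u = a"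
      using conj_unit(1)[OF u] by (simp add: mult_ac)
    ultimately have "poly B a = 0"
      by (simp add: poly_pcompose)
    thus False using b0 B(3) by simp
  qed
  have mult_square: "\<exists>f\<in>Z. poly B (u ^ 2 * a) = f * b" if u: "u ^ p = 1" for u
  proof -
    (* The element of modulus one: the conjugate of b for u, divided by its complex
       conjugate. *)
    define x where "x = poly B (u * a) / cnj (poly B (u * a))"
    have uL: "poly B (u * a) \<in> cyclotomic L"
      using B(1) KL subset_cyclotomic[OF L'(1)] root_cL[OF u] mem_adjoin[OF K'(1), of a]
      by (intro poly_mem[OF cL] csf_mult[OF cL]) (auto intro: poly_over_mono simp: L_def)
    have "x \<in> cyclotomic F"
    proof (rule radical_tower_unit_cyclotomic[OF tower[folded F_def L_def] F _ _ l])
      show "x \<in> cyclotomic L"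
        unfolding x_def by (intro csf_divide[OF cL] uL cyclotomic_cnj[OF L'])
      show "cmod x = 1"
        using conj_nz[OF u] by (simp add: x_def norm_divide)
      have "x ^ l = poly B (u * a) ^ l / cnj (poly B (u * a) ^ l)"
        by (simp add: x_def power_divide)
      also have "\<dots> \<in> Z"
        using pow_Z[OF u] cyclotomic_cnj[OF F' pow_Z[OF u, unfolded Z_def], folded Z_def]
        by (rule csf_divide[OF Z])
      finally show "x ^ l \<in> cyclotomic F" by (simp add: Z_def)
    qed
    hence "x \<in> adjoin (cyclotomic Q) a"
      using cyclotomic_adjoin_subset[OF Q'(1) p0 a(2)] by (auto simp: F_def)
    then obtain H where H: "poly_over (cyclotomic Q) H" "x = poly H a"
      by (auto simp: adjoin_def)
    (* The relation between the conjugates for u and cnj u holds at a; substituting u a for a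
       moves it to the conjugates for u^2 and 1. *)
    have "poly (pcompose B [:0, u:] - H * pcompose B [:0, cnj u:]) (u * a) = 0"
    proof (rule conjugate[OF _ _ u])
      show "poly_over (cyclotomic K) (pcompose B [:0, u:] - H * pcompose B [:0, cnj u:])"
        using H(1) cyclotomic_mono[OF K(2)] u conj_unit(2)[OF u]
        by (intro poly_over_diff[OF cK] poly_over_mult[OF cK] scale) (auto intro: poly_over_mono)
      have "poly B (u * a) = x * poly B (cnj u * a)"
        using conj_nz[OF u] by (simp add: x_def cnj_B[symmetric])
      thus "poly (pcompose B [:0, u:] - H * pcompose B [:0, cnj u:]) a = 0"
        using H(2) by (simp add: poly_pcompose mult.commute)
    qed
    hence "poly B (u * a * u) = poly H (u * a) * poly B (u * a * cnj u)"
      by (simp add: poly_pcompose)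
    moreover have "u * a * cnj u = a" "u * a * u = u ^ 2 * a"
      using conj_unit(1)[OF u] by (simp_all add: mult_ac power2_eq_square)
    ultimately have "poly B (u ^ 2 * a) = poly H (u * a) * b"
      using B(3) by simp
    moreover have "poly H (u * a) \<in> Z"
      using H(1) cyclotomic_mono[OF QF] root_Z[OF u] aZ
      by (intro poly_mem[OF Z] csf_mult[OF Z]) (auto simp: Z_def intro: poly_over_mono)
    ultimately show ?thesis by blast
  qed
  have mult: "\<exists>f\<in>Z. poly B (v * a) = f * b" if v: "v ^ p = 1" for v
  proof -
    (* A square root of v among the p-th roots of unity, as p is odd. *)
    define u where "u = v ^ ((p + 1) div 2)"
    have "2 * ((p + 1) div 2) = p + 1"
      using p(2) by presburger
    hence "u ^ 2 = v ^ (p + 1)"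
      by (metis u_def power_mult mult.commute)
    hence "u ^ 2 = v" using v by simp
    moreover have "u ^ p = 1"
      using v by (simp add: u_def power_mult[symmetric] mult.commute[of _ p]) (simp add: power_mult)
    ultimately show ?thesis
      using mult_square[of u] by simp
  qed
  obtain w :: complex where w: "w ^ p = 1" "\<And>i j. i < p \<Longrightarrow> j < p \<Longrightarrow> w ^ i = w ^ j \<Longrightarrow> i = j"
    using primitive_root_of_unity[OF p0] by blast
  have w_pow: "(w ^ j) ^ p = 1" for j
    using w(1) by (simp add: power_mult[symmetric] mult.commute[of _ p]) (simp add: power_mult)
  have coeff_pow: "coeff B i ^ l \<in> Q" if i: "i < p" for i
  proof -
    obtain f where f: "\<And>j. f j \<in> Z" "\<And>j. poly B (w ^ j * a) = f j * b"
      using mult[OF w_pow] by metis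
    (* By Fourier inversion p times coefficient i times a ^ i is s b. *)
    define s where "s = (\<Sum>j<p. cnj (w ^ j) ^ i * f j)"
    have sZ: "s \<in> Z"
      unfolding s_def using f(1) root_Z[OF conj_unit(2)[OF w_pow]]
      by (intro csf_sum[OF Z] csf_mult[OF Z] csf_power[OF Z])
    have "of_nat p * coeff B i * a ^ i = s * b"
      using coeff_from_conjugates[OF B(2) i w, of a]
      by (simp only: f(2) s_def sum_distrib_right mult.assoc)
    hence "coeff B i = s * b / (of_nat p * a ^ i)"
      using p0 a0 by (simp add: field_simps)
    hence "coeff B i ^ l = s ^ l * b ^ l / (of_nat p * a ^ i) ^ l"
      by (simp add: power_mult_distrib power_divide)
    also have "\<dots> \<in> Z"
    proof -
      have "b ^ l \<in> Z"
        using b(3) subset_cyclotomic[OF F'(1)] by (auto simp: Z_def F_def)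
      thus ?thesis
        using csf_divide[OF Z csf_mult[OF Z csf_power[OF Z sZ]]]
          csf_power[OF Z csf_mult[OF Z csf_of_nat[OF Z] csf_power[OF Z aZ]]] by blast
    qed
    finally have "coeff B i ^ l \<in> cyclotomic F" by (simp add: Z_def)
    moreover have cK: "coeff B i ^ l \<in> K"
      using B(1) by (intro csf_power[OF K'(1)]) (auto simp: poly_over_def)
    ultimately have "coeff B i ^ l \<in> F"
      using radical_tower_inter_cyclotomic[OF tower] F KL by (auto simp: F_def L_def)
    thus ?thesis
      using adjoin_exchange[OF Q'(1) K' K(2) a(1,2) p _ cK] a(3) by (auto simp: F_def)
  qed
  have "\<exists>i. coeff B i \<notin> Q"
  proof (rule ccontr)
    assume "\<not> (\<exists>i. coeff B i \<notin> Q)"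
    hence "b \<in> adjoin Q a"
      unfolding adjoin_def poly_over_def using B(3) by auto
    thus False using b(2) by simp
  qed
  then obtain i where i: "coeff B i \<notin> Q" by blast
  have "i < p"
  proof (rule ccontr)
    assume "\<not> i < p"
    hence "coeff B i = 0" using B(2) by (intro coeff_eq_0) simp
    thus False using i csf_0[OF Q'(1)] by simp
  qed
  thus ?thesis
    using that[of "coeff B i"] i coeff_pow B(1) by (auto simp: poly_over_def)
qed

text \<open>
  Adjoining \<open>c\<close> to all fields of a tower makes the first step that produces \<open>c\<close> trivial,
  because a step of prime degree is generated by each of its new elements. The tower over
  \<open>S(c)\<close> is thus shorter, and its length can serve as induction measure in place of the
  degree.
\<close>

lemma radical_tower_absorb:
  assumes "radical_tower n S T" "real_subfield S" "c \<in> T" "c \<notin> S" "c ^ l \<in> S" "prime l" "odd l"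
  shows "\<exists>m. n = Suc m \<and> radical_tower m (adjoin S c) T"
  using assms
proof induction
  case (step d q S n T)
  have S: "complex_subfield S"
    using step.prems(1) by (rule real_subfieldD)
  have Sd: "real_subfield (adjoin S d)"
    using real_subfield_adjoin step by blast
  have "c \<in> \<real>"
    using radical_tower_real(1)[OF step.hyps(5) Sd] step.prems(2) by (auto simp: real_subfield_def)
  hence Sc: "real_subfield (adjoin S c)"
    using real_subfield_adjoin step by blast
  have sub: "S \<subseteq> adjoin S c" "S \<subseteq> adjoin S d" "c \<in> adjoin S c" "d \<in> adjoin S d"
    using S by (auto intro: mem_adjoin subsetD[OF subset_adjoin])
  show ?case
  proof (cases "c \<in> adjoin S d")
    case True
    have "d \<in> adjoin S c"
      using adjoin_exchange[OF S real_subfieldD[OF Sc] sub(1) _ _ _ _ True sub(3)] step by blast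
    hence "adjoin S d = adjoin S c"
      using True sub Sc Sd by (intro equalityI adjoin_subset) (auto simp: real_subfield_def)
    thus ?thesis using step.hyps by auto
  next
    case False
    have "c ^ l \<in> adjoin S d" using step.prems sub by blast
    then obtain m where m: "n = Suc m" "radical_tower m (adjoin (adjoin S d) c) T"
      using step.IH[OF Sd step.prems(2) False] step.prems by blast
    have "d ^ q \<in> adjoin S c" using step.hyps sub by blast
    have Sdc: "complex_subfield (adjoin (adjoin S d) c)"
      using real_subfield_adjoin[OF Sd \<open>c \<in> \<real>\<close> \<open>c ^ l \<in> adjoin S d\<close>] step.prems
      by (auto simp: real_subfield_def)
    have Scd: "complex_subfield (adjoin (adjoin S c) d)"
      using real_subfield_adjoin[OF Sc step.hyps(1) \<open>d ^ q \<in> adjoin S c\<close>] step.hyps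
      by (auto simp: real_subfield_def)
    note Sd' = real_subfieldD(1)[OF Sd] and Sc' = real_subfieldD(1)[OF Sc]
    have "adjoin (adjoin S d) c = adjoin (adjoin S c) d"
      using sub subset_adjoin[OF Sd', of c] subset_adjoin[OF Sc', of d] mem_adjoin[OF Sd', of c]
        mem_adjoin[OF Sc', of d] Scd Sdc
      by (intro equalityI adjoin_subset) blast+
    hence "radical_tower n (adjoin S c) T"
      using m step.hyps \<open>d ^ q \<in> adjoin S c\<close> by (auto intro: radical_tower.step)
    thus ?thesis by blast
  qed
qed auto

text \<open>
  Let \<open>F = Q(d)\<close> be the first step. If \<open>d\<close> is in \<open>K\<close>, induction applies over \<open>F\<close>.
  Otherwise the top field may be replaced by \<open>K(d)\<close>, which has a shorter tower over \<open>F\<close> by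
  induction. If this tower is trivial, then \<open>K\<close> is contained in \<open>Q(d)\<close> and equals \<open>Q\<close>. If
  not, \<open>radical_in_subfield\<close> turns its first radical into a radical \<open>c\<close> of \<open>K\<close> over \<open>Q\<close>,
  and induction applies over \<open>Q(c)\<close>.
\<close>

theorem radical_tower_intermediate:
  assumes "radical_tower n Q L" "real_subfield Q" "complex_subfield K" "Q \<subseteq> K" "K \<subseteq> L"
  shows "radical_tower n Q K"
  using assms
proof (induction n arbitrary: Q L K)
  case 0
  hence "L = Q" by (auto elim: radical_tower.cases)
  thus ?case using 0 by (auto intro: radical_tower.trivial)
next
  case (Suc n)
  have L: "real_subfield L"
    using radical_tower_real Suc.prems by blast
  have K: "real_subfield K"
    using Suc.prems L by (auto simp: real_subfield_def)
  have Q': "complex_subfield Q"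
    using Suc.prems(2) by (rule real_subfieldD)
  from Suc.prems(1) show ?case
  proof (cases rule: radical_tower.cases)
    case trivial
    thus ?thesis using Suc.prems by (auto intro: radical_tower.trivial)
  next
    case (step d q)
    define F where "F = adjoin Q d"
    have F: "real_subfield F"
      unfolding F_def using step Suc.prems(2) real_subfield_adjoin by blast
    have FL: "radical_tower n F L" using step by (simp add: F_def)
    have "d \<in> L"
      using radical_tower_real(2)[OF FL F] mem_adjoin[OF Q', of d] by (auto simp: F_def)
    show ?thesis
    proof (cases "d \<in> K")
      case True
      hence "F \<subseteq> K"
        unfolding F_def using Suc.prems by (intro adjoin_subset)
      hence "radical_tower n F K"
        using Suc.IH[OF FL F] Suc.prems by blast
      thus ?thesis
        using step by (auto simp: F_def intro: radical_tower.step)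
    next
      case False
      define L1 where "L1 = adjoin K d"
      have dK: "d ^ q \<in> K" using step Suc.prems by blast
      have L1: "complex_subfield L1"
        unfolding L1_def using real_subfield_adjoin[OF K step(1) dK] step by (simp add: real_subfieldD)
      have "F \<subseteq> L1"
        unfolding F_def L1_def using Suc.prems by (intro adjoin_mono)
      moreover have "L1 \<subseteq> L"
        unfolding L1_def using Suc.prems \<open>d \<in> L\<close> L by (intro adjoin_subset) (auto simp: real_subfieldD)
      ultimately have FL1: "radical_tower n F L1"
        using Suc.IH[OF FL F L1] by blast
      show ?thesis
      proof (cases "F = L1")
        case True
        have "y \<in> Q" if "y \<in> K" for y
        proof (rule ccontr)
          assume "y \<notin> Q"
          moreover have "y \<in> adjoin Q d"
            using that True subset_adjoin[OF real_subfieldD(1)[OF K]] by (auto simp: F_def L1_def)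
          ultimately show False
            using adjoin_exchange[OF Q' real_subfieldD[OF K] Suc.prems(4)] that step False by blast
        qed
        hence "K = Q" using Suc.prems by blast
        thus ?thesis by (auto intro: radical_tower.trivial)
      next
        case F_ne_L1: False
        obtain b l where b: "b \<in> L1" "b \<notin> F" "prime l" "odd l" "b ^ l \<in> F"
          using radical_tower_nontrivial[OF FL1 F F_ne_L1] by blast
        obtain c where c: "c \<in> K" "c \<notin> Q" "c ^ l \<in> Q"
          using radical_in_subfield[OF Suc.prems(2) K Suc.prems(4) step(1,4) False step(2,3)
              FL1[unfolded F_def L1_def] b(1,2,5)[unfolded F_def L1_def] prime_gt_0_nat[OF b(3)]]
          by blast
        have "c \<in> \<real>" using c K by (auto simp: real_subfield_def)
        hence Qc: "real_subfield (adjoin Q c)"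
          using real_subfield_adjoin Suc.prems c b by blast
        have "radical_tower n (adjoin Q c) L"
          using radical_tower_absorb[OF Suc.prems(1,2) _ c(2,3) b(3,4)] c Suc.prems by blast
        moreover have "adjoin Q c \<subseteq> K"
          using Suc.prems c by (intro adjoin_subset)
        ultimately have "radical_tower n (adjoin Q c) K"
          using Suc.IH[OF _ Qc] Suc.prems by blast
        thus ?thesis
          using \<open>c \<in> \<real>\<close> b c by (auto intro: radical_tower.step)
      qed
    qed
  qed
qed

section \<open>Embeddings of abstract fields into the complex numbers\<close>

abbreviation complex_ring :: "complex ring" where
  "complex_ring \<equiv> ring_of_type_algebra"

lemma complex_ring_simps [simp]:
  "carrier complex_ring = UNIV" "monoid.mult complex_ring = (*)" "monoid.one complex_ring = 1"
  "ring.zero complex_ring = 0" "ring.add complex_ring = (+)"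
  by (auto simp: ring_of_type_algebra_def)

lemma complex_ring_pow [simp]: "x [^]\<^bsub>complex_ring\<^esub> (n::nat) = x ^ n"
proof -
  interpret CR: ring complex_ring by (rule ring_from_type_algebra)
  show ?thesis by (induction n) (simp_all add: mult.commute)
qed

context field
begin

text \<open>
  The map \<open>h\<close> is a field homomorphism on \<open>K\<close>; its values outside of \<open>K\<close> are arbitrary,
  which allows to restrict and to compare such maps without changing them.
\<close>

definition complex_hom :: "'a set \<Rightarrow> ('a \<Rightarrow> complex) \<Rightarrow> bool" where
  "complex_hom K h \<longleftrightarrow> h \<one> = 1 \<and> (\<forall>x\<in>K. \<forall>y\<in>K. h (x \<oplus> y) = h x + h y \<and> h (x \<otimes> y) = h x * h y)"

context
  fixes K h assumes K: "subfield K R" and h: "complex_hom K h"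
begin

lemma complex_hom_ring_hom: "ring_hom_ring (R\<lparr>carrier := K\<rparr>) complex_ring h"
  using h subring_is_ring[OF subfieldE(1)[OF K]] ring_from_type_algebra
  by (intro ring_hom_ringI2) (auto simp: complex_hom_def ring_hom_def)

lemma complex_hom_1: "h \<one> = 1"
  and complex_hom_add: "x \<in> K \<Longrightarrow> y \<in> K \<Longrightarrow> h (x \<oplus> y) = h x + h y"
  and complex_hom_mult: "x \<in> K \<Longrightarrow> y \<in> K \<Longrightarrow> h (x \<otimes> y) = h x * h y"
  using h by (auto simp: complex_hom_def)

lemma complex_hom_0: "h \<zero> = 0"
  using complex_hom_add[of \<zero> \<zero>] subringE(2)[OF subfieldE(1)[OF K]] by simp

lemma complex_hom_uminus: "x \<in> K \<Longrightarrow> h (\<ominus> x) = - h x"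
  using complex_hom_add[of x "\<ominus> x"] subringE(5)[OF subfieldE(1)[OF K]] subfieldE(3)[OF K]
  by (simp add: r_neg subset_iff complex_hom_0 add_eq_0_iff)

lemma complex_hom_pow: "x \<in> K \<Longrightarrow> h (x [^] (n::nat)) = h x ^ n"
proof (induction n)
  case (Suc n)
  have "x [^] n \<in> K"
    using Suc.prems subringE(3,6)[OF subfieldE(1)[OF K]] by (induction n) auto
  thus ?case using Suc by (simp add: complex_hom_mult mult.commute)
qed (simp add: complex_hom_1)

lemma complex_hom_inv:
  assumes "x \<in> K" "x \<noteq> \<zero>"
  shows "h (inv x) = inverse (h x)"
proof -
  have "inv x \<in> K" "x \<otimes> inv x = \<one>"
    using subfield_m_inv[OF K, of x] assms by auto
  hence "h x * h (inv x) = 1"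
    using complex_hom_mult[OF assms(1), of "inv x"] complex_hom_1 by simp
  thus ?thesis by (metis inverse_unique)
qed

lemma complex_hom_inj: "inj_on h K"
proof (rule inj_onI)
  fix x y assume xy: "x \<in> K" "y \<in> K" "h x = h y"
  have d: "x \<ominus> y \<in> K"
    using xy subringE(5,7)[OF subfieldE(1)[OF K]] by (simp add: a_minus_def)
  have hd: "h (x \<ominus> y) = 0"
    using xy subringE(5)[OF subfieldE(1)[OF K]]
    by (simp add: a_minus_def complex_hom_add complex_hom_uminus)
  have "x \<ominus> y = \<zero>"
  proof (rule ccontr)
    assume nz: "x \<ominus> y \<noteq> \<zero>"
    hence "inv (x \<ominus> y) \<in> K" "(x \<ominus> y) \<otimes> inv (x \<ominus> y) = \<one>"
      using subfield_m_inv[OF K, of "x \<ominus> y"] d by auto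
    hence "1 = h (x \<ominus> y) * h (inv (x \<ominus> y))"
      using complex_hom_mult[OF d] complex_hom_1 by metis
    thus False using hd by simp
  qed
  thus "x = y"
    using xy subfieldE(3)[OF K] by (meson r_right_minus_eq subset_iff)
qed

lemma complex_hom_image: "complex_subfield (h ` K)"
  unfolding complex_subfield_def
proof (intro conjI ballI)
  note closed = subringE(2,3,5,6,7)[OF subfieldE(1)[OF K]]
  show "1 \<in> h ` K"
    using complex_hom_1 closed(2) by force
  fix u assume "u \<in> h ` K"
  then obtain x where x: "x \<in> K" "u = h x" by blast
  show "inverse u \<in> h ` K"
  proof (cases "x = \<zero>")
    case True
    thus ?thesis using x by (auto simp: complex_hom_0 intro!: image_eqI[of _ _ \<zero>])
  next
    case False
    thus ?thesis
      using complex_hom_inv[OF x(1) False] subfield_m_inv(1)[OF K, of x] x by force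
  qed
  fix v assume "v \<in> h ` K"
  then obtain y where y: "y \<in> K" "v = h y" by blast
  show "u - v \<in> h ` K"
    using x y closed complex_hom_add[of x "\<ominus> y"] complex_hom_uminus[of y]
    by (intro image_eqI[of _ _ "x \<oplus> \<ominus> y"]) auto
  show "u * v \<in> h ` K"
    using x y closed complex_hom_mult[of x y] by (intro image_eqI[of _ _ "x \<otimes> y"]) auto
qed

end

lemma complex_hom_subset: "complex_hom K h \<Longrightarrow> K' \<subseteq> K \<Longrightarrow> complex_hom K' h"
  by (auto simp: complex_hom_def)

text \<open>
  Matches the notion of generated field for abstract fields with the one for complex
  numbers: both consist of the values of polynomials, built up by a Horner scheme.
\<close>

lemma complex_hom_simple_extension:
  assumes K: "subfield K R" and h: "complex_hom K h"
    and K': "K' \<subseteq> K" "subfield K' R" and a: "a \<in> K"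
  shows "h ` simple_extension K' a = adjoin (h ` K') (h a)"
proof
  have sub: "simple_extension K' a \<subseteq> K"
    using simple_extension_subring_incl[OF subfieldE(1)[OF K] K'(1) a] .
  have S: "complex_subfield (h ` K')"
    using complex_hom_image[OF K'(2) complex_hom_subset[OF h K'(1)]] .
  note complex_hom_0 = complex_hom_0[OF K h] and complex_hom_add = complex_hom_add[OF K h]
    and complex_hom_mult = complex_hom_mult[OF K h]
  show "h ` simple_extension K' a \<subseteq> adjoin (h ` K') (h a)"
  proof (rule image_subsetI)
    fix x assume "x \<in> simple_extension K' a"
    thus "h x \<in> adjoin (h ` K') (h a)"
    proof induction
      case zero
      show ?case
        using subset_adjoin[OF S] csf_0[OF S] complex_hom_0 by auto
    next
      case (lin x k)
      obtain p where p: "poly_over (h ` K') p" "h x = poly p (h a)"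
        using lin.IH by (auto simp: adjoin_def)
      have "x \<otimes> a \<in> K" "k \<in> K" "x \<in> K"
        using lin.hyps sub a K' subringE(6)[OF subfieldE(1)[OF K]] by auto
      hence "h (x \<otimes> a \<oplus> k) = poly (pCons (h k) p) (h a)"
        using a by (simp add: complex_hom_add complex_hom_mult p(2) mult.commute)
      moreover have "poly_over (h ` K') (pCons (h k) p)"
        using p(1) lin.hyps by (intro poly_over_pCons[OF S]) auto
      ultimately show ?case unfolding adjoin_def by blast
    qed
  qed
  show "adjoin (h ` K') (h a) \<subseteq> h ` simple_extension K' a"
  proof
    fix u assume "u \<in> adjoin (h ` K') (h a)"
    then obtain p where "poly_over (h ` K') p" "u = poly p (h a)"
      by (auto simp: adjoin_def)
    thus "u \<in> h ` simple_extension K' a"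
    proof (induction p arbitrary: u)
      case 0
      thus ?case using complex_hom_0 by (auto intro!: image_eqI[of _ _ \<zero>])
    next
      case (pCons c p)
      have over: "c \<in> h ` K'" "poly_over (h ` K') p"
        using pCons.prems(1) by (auto simp: poly_over_def coeff_pCons split: nat.splits)
      obtain x where x: "x \<in> simple_extension K' a" "poly p (h a) = h x"
        using pCons.IH[OF over(2)] by auto
      obtain k where k: "k \<in> K'" "c = h k" using over(1) by auto
      have "x \<otimes> a \<in> K" "k \<in> K" "x \<in> K"
        using x k sub a K' subringE(6)[OF subfieldE(1)[OF K]] by auto
      hence "u = h (x \<otimes> a \<oplus> k)"
        using pCons.prems(2) x k a
        by (simp add: complex_hom_add complex_hom_mult mult.commute)
      thus ?case
        using simple_extension.lin[OF x(1) k(1)] by blast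
    qed
  qed
qed

text \<open>
  The element \<open>a\<close> is a root of \<open>X ^ n - a ^ n\<close>.
\<close>

lemma root_imp_algebraic:
  assumes K: "subfield K R" and a: "a \<in> carrier R" "a [^] n \<in> K" "n > (0::nat)"
  shows "(algebraic over K) a"
proof (rule algebraicI)
  define c where "c = \<ominus> (a [^] n)"
  (* X ^ n - a ^ n as a list of coefficients, with n - 1 zeros between the two ends. *)
  define p where "p = (\<one> # replicate (n - 1) \<zero>) @ [c]"
  have c: "c \<in> K" "c \<in> carrier R"
    using a(2) subringE(5)[OF subfieldE(1)[OF K]] subfieldE(3)[OF K] by (auto simp: c_def)
  have "set p \<subseteq> K"
    using c subringE(2,3)[OF subfieldE(1)[OF K]] by (auto simp: p_def)
  thus "p \<in> carrier (K[X])"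
    using one_not_zero by (simp add: univ_poly_def polynomial_def) (simp add: p_def)
  show "p \<noteq> []" by (simp add: p_def)
  have "eval (\<one> # replicate (n - 1) \<zero>) a = a [^] (n - 1)"
    using a(1) eval_replicate[of "[]" a "n - 1"] by simp
  moreover have "set (\<one> # replicate (n - 1) \<zero>) \<subseteq> carrier R" by auto
  ultimately have "eval p a = a [^] (n - 1) \<otimes> a \<oplus> c"
    unfolding p_def using eval_append_aux[of "\<one> # replicate (n - 1) \<zero>" c a] c(2) a(1) by simp
  also have "a [^] (n - 1) \<otimes> a = a [^] n"
    using a(3) nat_pow_Suc[of a "n - 1"] by simp
  finally show "eval p a = \<zero>"
    using a(1) by (simp add: c_def r_neg)
qed

lemma simple_radical_subfield:
  assumes K: "subfield K R" and a: "a \<in> carrier R" "a [^] n \<in> K" "n > (0::nat)"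
  shows "subfield (simple_extension K a) R"
  using simple_extension_is_subfield[OF K a(1)] root_imp_algebraic[OF assms] by simp

section \<open>Pulling towers back along an embedding\<close>

lemma repeated_radical_extension_Cons:
  assumes "radical_extension Q F" "repeated_radical_extension F E"
  shows "repeated_radical_extension Q E"
proof -
  obtain r L where L: "L 0 = F" "L r = E" "\<forall>i\<le>r. subfield (L i) R"
    "\<forall>i<r. radical_extension (L i) (L (Suc i))"
    using assms(2) by (auto simp: repeated_radical_extension_def)
  define L' where "L' = (\<lambda>i. case i of 0 \<Rightarrow> Q | Suc i \<Rightarrow> L i)"
  have "L' 0 = Q" "L' (Suc r) = E"
    using L by (auto simp: L'_def)
  moreover have "subfield (L' i) R" if "i \<le> Suc r" for i
    using that L assms(1) by (cases i) (auto simp: L'_def radical_extension_def)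
  moreover have "radical_extension (L' i) (L' (Suc i))" if "i < Suc r" for i
    using that L assms(1) by (cases i) (auto simp: L'_def)
  ultimately show ?thesis
    unfolding repeated_radical_extension_def by blast
qed

lemma repeated_radical_extension_refl:
  "subfield Q R \<Longrightarrow> repeated_radical_extension Q Q"
  unfolding repeated_radical_extension_def
  by (intro exI[of _ 0] exI[of _ "\<lambda>_. Q"]) auto

text \<open>
  Each radical of a tower between \<open>h ` Q\<close> and \<open>h ` K\<close> is the image of an element of \<open>K\<close>,
  whose power is in the preimage of the smaller field because \<open>h\<close> is injective.
\<close>

lemma radical_tower_pullback:
  assumes "radical_tower n S T" "S = h ` Q" "T = h ` K"
    and "subfield Q R" "subfield K R" "Q \<subseteq> K" "complex_hom K h" "h ` K \<subseteq> \<real>"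
  shows "repeated_radical_extension Q K"
  using assms
proof (induction arbitrary: Q)
  case (trivial n S)
  have "Q = K"
    using inj_on_image_eq_iff[OF complex_hom_inj[OF trivial(4,6)], of Q K] trivial by auto
  thus ?case using trivial repeated_radical_extension_refl by simp
next
  case (step d q S n T)
  note Q = \<open>subfield Q R\<close> and K = \<open>subfield K R\<close> and hK = \<open>complex_hom K h\<close> and QK = \<open>Q \<subseteq> K\<close>
  have hQ: "complex_hom Q h"
    using hK QK by (auto simp: complex_hom_def)
  have S: "real_subfield S"
    using complex_hom_image[OF Q hQ] step.prems by (auto simp: real_subfield_def)
  have "adjoin S d \<subseteq> T"
    using radical_tower_real(2)[OF step.hyps(5)] real_subfield_adjoin[OF S] step.hyps by blast
  hence "d \<in> h ` K"
    using mem_adjoin[OF real_subfieldD(1)[OF S], of d] step.prems by blast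
  then obtain a where a: "a \<in> K" "d = h a" by blast
  have q0: "q > 0" using step.hyps prime_gt_0_nat by blast
  have aR: "a \<in> carrier R" using a(1) subfieldE(3)[OF K] by blast
  have "a [^] q \<in> K"
    using a(1) subringE(3,6)[OF subfieldE(1)[OF K]] by (induction q) auto
  moreover have "h (a [^] q) \<in> h ` Q"
    using step.hyps(4) step.prems(1) a complex_hom_pow[OF K hK] by simp
  ultimately have aq: "a [^] q \<in> Q"
    using complex_hom_inj[OF K hK] QK by (auto dest: inj_onD)
  define F where "F = simple_extension Q a"
  have F: "subfield F R"
    unfolding F_def by (rule simple_radical_subfield[OF Q aR aq q0])
  have FK: "F \<subseteq> K"
    unfolding F_def using simple_extension_subring_incl[OF subfieldE(1)[OF K] QK a(1)] .
  have "adjoin S d = h ` F"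
    unfolding F_def using complex_hom_simple_extension[OF K hK QK Q a(1)] step.prems(1) a(2) by simp
  hence "repeated_radical_extension F K"
    using step.IH F FK step.prems by blast
  moreover have "radical_extension Q F"
    unfolding radical_extension_def F_def
    using Q F simple_extension_incl[OF subfieldE(3)[OF Q] aR]
      simple_extension_mem[OF subfieldE(1)[OF Q] aR] aq q0 by (auto simp: F_def)
  ultimately show ?case
    by (rule repeated_radical_extension_Cons[rotated])
qed

end

section \<open>Real embeddings of extensions of odd degree\<close>

lemma radical_tower_trans:
  assumes "radical_tower n S T" "radical_tower m T U"
  shows "\<exists>k. radical_tower k S U"
  using assms
proof induction
  case (step d q S n T)
  thus ?case
    using radical_tower.step[OF step.hyps(1-4)] by blast
qed blast

text \<open>
  Splits a root of odd exponent \<open>d = q k\<close>, \<open>q\<close> prime, into the \<open>q\<close>-th root \<open>y ^ k\<close> and a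
  \<open>k\<close>-th root of it.
\<close>

lemma radical_tower_odd_power:
  assumes "real_subfield S" "y \<in> \<real>" "odd d" "y ^ d \<in> S"
  shows "\<exists>n. radical_tower n S (adjoin S y)"
  using assms
proof (induction d arbitrary: S rule: less_induct)
  case (less d)
  have S: "complex_subfield S"
    using less.prems(1) by (rule real_subfieldD)
  show ?case
  proof (cases "d = 1")
    case True
    thus ?thesis
      using less.prems adjoin_mem_eq[OF S] by (auto intro: radical_tower.trivial)
  next
    case False
    then obtain q where q: "prime q" "q dvd d"
      using prime_factor_nat by blast
    then obtain k where k: "d = q * k" by (auto elim: dvdE)
    have "k > 0" using less.prems(3) k by (intro Nat.gr0I) auto
    have odd: "odd q" "odd k"
      using less.prems(3) k by auto
    define e where "e = y ^ k"
    have e: "e \<in> \<real>" "e ^ q \<in> S"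
      using less.prems k by (auto simp: e_def mult.commute simp flip: power_mult)
    have S1: "real_subfield (adjoin S e)"
      using real_subfield_adjoin less.prems(1) e q(1) by blast
    have "k < d"
      using \<open>k > 0\<close> q(1) prime_gt_1_nat[of q] by (simp add: k)
    moreover have "y ^ k \<in> adjoin S e"
      using mem_adjoin[OF S] by (simp add: e_def)
    ultimately obtain n where n: "radical_tower n (adjoin S e) (adjoin (adjoin S e) y)"
      using less.IH S1 less.prems(2) odd(2) by blast
    have "d > 0" using less.prems(3) by (intro Nat.gr0I) auto
    have Sy: "complex_subfield (adjoin S y)"
      using adjoin_radical_subfield[OF S \<open>d > 0\<close> less.prems(4)] .
    have Sey: "complex_subfield (adjoin (adjoin S e) y)"
      using adjoin_radical_subfield[OF real_subfieldD(1)[OF S1] \<open>k > 0\<close>] mem_adjoin[OF S, of e]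
      by (simp add: e_def)
    have "e \<in> adjoin S y"
      unfolding e_def by (intro csf_power[OF Sy] mem_adjoin[OF S])
    hence "adjoin (adjoin S e) y = adjoin S y"
      using subset_adjoin[OF S] mem_adjoin[OF S] Sy Sey
      by (intro equalityI adjoin_subset adjoin_mono) auto
    thus ?thesis
      using n e q odd by (auto intro: radical_tower.step)
  qed
qed

lemma odd_degree_real_root_pos:
  fixes p :: "real poly"
  assumes "odd (degree p)" "lead_coeff p > 0"
  shows "\<exists>x. poly p x = 0"
proof -
  obtain a where a: "\<And>x. x \<ge> a \<Longrightarrow> poly p x \<ge> lead_coeff p"
    using poly_pinfty_gt_lc[OF assms(2)] by blast
  define r where "r = - pcompose p [:0, -1:]"
  have "degree (pcompose p [:0, -1:]) = degree p"
    by (simp add: degree_pcompose)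
  hence "lead_coeff r = lead_coeff p"
    using assms(1) by (simp add: r_def coeff_pcompose_linear)
  then obtain b where b: "\<And>x. x \<ge> b \<Longrightarrow> poly r x \<ge> lead_coeff p"
    using poly_pinfty_gt_lc[of r] assms(2) by auto
  define c where "c = max 1 (max a b)"
  have "a \<le> c" "b \<le> c" by (simp_all add: c_def)
  hence "poly p c > 0" "poly r c > 0"
    using a b assms(2) \<open>lead_coeff r = lead_coeff p\<close> by fastforce+
  moreover from this have "poly p (- c) < 0"
    by (simp add: r_def poly_pcompose)
  moreover have "- c < c" by (simp add: c_def)
  ultimately show ?thesis
    using poly_IVT_pos by blast
qed

lemma odd_degree_real_root:
  assumes p: "poly_over \<real> p" "lead_coeff p = 1" "odd (degree p)"
  obtains y where "y \<in> \<real>" "poly p y = 0"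
proof -
  define r where "r = map_poly Re p"
  have coeff_r: "coeff r i = Re (coeff p i)" for i
    by (simp add: r_def coeff_map_poly)
  have "degree r \<le> degree p"
    by (intro degree_le) (simp add: coeff_r coeff_eq_0)
  moreover have "coeff r (degree p) = 1"
    using p(2) by (simp add: coeff_r)
  hence "degree p \<le> degree r" by (intro le_degree) simp
  ultimately have deg: "degree r = degree p" by simp
  then obtain x where x: "poly r x = 0"
    using odd_degree_real_root_pos[of r] p by (auto simp: coeff_r)
  have "coeff p i = of_real (coeff r i)" for i
    using p(1) by (auto simp: poly_over_def coeff_r of_real_Re)
  hence "poly p (of_real x) = of_real (poly r x)"
    by (simp add: poly_altdef deg)
  thus ?thesis
    using that[of "of_real x"] x by simp
qed

text \<open>
  The constant coefficient of \<open>p\<close> is, up to sign, the product of the roots, so its modulus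
  is that of \<open>y ^ degree p\<close>; two real numbers of the same modulus differ at most by the
  sign. For the minimal polynomial \<open>p\<close> of a real radical \<open>y\<close> this means that the exponent
  can be taken to be the degree.
\<close>

lemma equal_modulus_roots_power_mem:
  assumes S: "real_subfield S" and p: "poly_over S p" "lead_coeff p = 1"
    and y: "y \<in> \<real>" and roots: "\<And>z. poly p z = 0 \<Longrightarrow> cmod z = cmod y"
  shows "y ^ degree p \<in> S"
proof -
  have S': "complex_subfield S" "S \<subseteq> \<real>" using S by (auto simp: real_subfield_def)
  have "p \<noteq> 0" using p by auto
  then obtain A where A: "size A = degree p" "p = (\<Prod>x\<in>#A. [:- x, 1:])"
    using alg_closed_imp_factorization[of p] p(2) by auto
  have "cmod x = cmod y" if "x \<in># A" for x
  proof (rule roots)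
    show "poly p x = 0"
      unfolding A(2) poly_prod_mset using that
      by (auto simp: prod_mset_zero_iff intro!: image_eqI[of _ _ x])
  qed
  hence "cmod (\<Prod>x\<in>#A. - x) = cmod y ^ size A"
    by (induction A) (auto simp: norm_mult)
  moreover have "poly p 0 = (\<Prod>x\<in>#A. - x)"
    unfolding A(2) poly_prod_mset by (simp add: multiset.map_comp comp_def)
  ultimately have norm: "cmod (poly p 0) = cmod (y ^ degree p)"
    using A(1) by (simp add: norm_power)
  have mem: "poly p 0 \<in> S"
    using poly_mem[OF S'(1) p(1) csf_0[OF S'(1)]] .
  have "y ^ degree p \<in> \<real>" using y by simp
  then obtain a b where "y ^ degree p = of_real a" "poly p 0 = of_real b"
    using mem S'(2) by (auto elim!: Reals_cases)
  hence "y ^ degree p = poly p 0 \<or> y ^ degree p = - poly p 0"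
    using norm by (auto simp: abs_eq_iff)
  thus ?thesis
    using mem csf_uminus[OF S'(1) mem] by auto
qed

text \<open>
  The image of a polynomial under \<open>h\<close>. The polynomials of an abstract ring are lists that
  start with the leading coefficient, hence the reversal.
\<close>

definition coeff_poly :: "('a \<Rightarrow> complex) \<Rightarrow> 'a list \<Rightarrow> complex poly" where
  "coeff_poly h p = Poly (rev (map h p))"

lemma poly_coeff_poly:
  "poly (coeff_poly h p) y = ring.eval complex_ring (map h p) y"
proof -
  interpret CR: ring complex_ring by (rule ring_from_type_algebra)
  show ?thesis
    by (induction p) (simp_all add: coeff_poly_def Poly_append poly_monom mult.commute)
qed

lemma coeff_poly_monic:
  assumes S: "complex_subfield S" and h: "h c = 1" "h ` set l \<subseteq> S"
  shows "degree (coeff_poly h (c # l)) = length l" "lead_coeff (coeff_poly h (c # l)) = 1"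
    "poly_over S (coeff_poly h (c # l))"
proof -
  define p where "p = coeff_poly h (c # l)"
  have "p = Poly (rev (map h l)) + monom 1 (length l)"
    using h(1) by (simp add: p_def coeff_poly_def Poly_append)
  hence coeff_p: "coeff p i = (if i < length l then rev (map h l) ! i else if i = length l then 1 else 0)" for i
    by (auto simp: coeff_Poly_eq nth_default_def)
  show deg: "degree p = length l"
  proof (rule antisym)
    show "degree p \<le> length l" by (intro degree_le) (simp add: coeff_p)
    show "length l \<le> degree p" by (intro le_degree) (simp add: coeff_p)
  qed
  show "lead_coeff p = 1"
    by (simp add: deg coeff_p)
  show "poly_over S p"
    unfolding poly_over_def
  proof
    fix i
    have "rev (map h l) ! i \<in> S" if "i < length l"
      using nth_mem[of i "rev (map h l)"] that h(2) by auto
    thus "coeff p i \<in> S"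
      using csf_0[OF S] csf_1[OF S] by (auto simp: coeff_p)
  qed
qed

context field
begin

context
  fixes K h assumes K: "subfield K R" and h: "complex_hom K h"
begin

lemma poly_coeff_poly_hom:
  assumes "p \<in> carrier (K[X])" "q \<in> carrier (K[X])"
  shows "poly (coeff_poly h (p \<oplus>\<^bsub>K[X]\<^esub> q)) y = poly (coeff_poly h p) y + poly (coeff_poly h q) y"
    and "poly (coeff_poly h (p \<otimes>\<^bsub>K[X]\<^esub> q)) y = poly (coeff_poly h p) y * poly (coeff_poly h q) y"
proof -
  interpret CR: cring complex_ring by (rule cring_from_type_algebra)
  interpret H: ring_hom_ring "R\<lparr>carrier := K\<rparr>" complex_ring h
    by (rule complex_hom_ring_hom[OF K h])
  have sub: "subring K R" by (rule subfieldE(1)[OF K])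
  have pq: "set p \<subseteq> K" "set q \<subseteq> K"
    using assms by (auto simp: univ_poly_def polynomial_def)
  have ev: "ring.eval complex_ring (ring.normalize complex_ring l) y = ring.eval complex_ring l y" for l
    by (rule CR.eval_normalize) auto
  show "poly (coeff_poly h (p \<oplus>\<^bsub>K[X]\<^esub> q)) y = poly (coeff_poly h p) y + poly (coeff_poly h q) y"
  proof -
    have "ring.normalize complex_ring (map h (poly_add p q)) = ring.poly_add complex_ring (map h p) (map h q)"
      using H.poly_add_hom'[of p q] pq unfolding poly_add_consistent[OF sub] by simp
    hence "ring.eval complex_ring (map h (poly_add p q)) y = ring.eval complex_ring (ring.poly_add complex_ring (map h p) (map h q)) y"
      using ev by metis
    also have "\<dots> = ring.eval complex_ring (map h p) y + ring.eval complex_ring (map h q) y"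
      using CR.eval_poly_add[of "map h p" "map h q" y] by simp
    finally show ?thesis
      unfolding poly_coeff_poly univ_poly_add .
  qed
  show "poly (coeff_poly h (p \<otimes>\<^bsub>K[X]\<^esub> q)) y = poly (coeff_poly h p) y * poly (coeff_poly h q) y"
  proof -
    have "ring.normalize complex_ring (map h (poly_mult p q)) = ring.poly_mult complex_ring (map h p) (map h q)"
      using H.poly_mult_hom'[of p q] pq unfolding poly_mult_consistent[OF sub] by simp
    hence "ring.eval complex_ring (map h (poly_mult p q)) y = ring.eval complex_ring (ring.poly_mult complex_ring (map h p) (map h q)) y"
      using ev by metis
    also have "\<dots> = ring.eval complex_ring (map h p) y * ring.eval complex_ring (map h q) y"
      using CR.eval_poly_mult[of "map h p" "map h q" y] by simp
    finally show ?thesis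
      unfolding poly_coeff_poly univ_poly_mult .
  qed
qed

text \<open>
  The two polynomials differ by a multiple of the minimal polynomial of \<open>a\<close>, whose image
  vanishes at \<open>y\<close>.
\<close>

lemma coeff_poly_well_defined:
  assumes a: "a \<in> carrier R" "(algebraic over K) a"
    and y: "poly (coeff_poly h (Irr K a)) y = 0"
    and pq: "p \<in> carrier (K[X])" "q \<in> carrier (K[X])" "eval p a = eval q a"
  shows "poly (coeff_poly h p) y = poly (coeff_poly h q) y"
proof -
  have sub: "subring K R" by (rule subfieldE(1)[OF K])
  interpret UP: domain "K[X]"
    by (rule univ_poly_is_domain[OF sub])
  interpret E: ring_hom_ring "K[X]" R "\<lambda>p. eval p a"
    by (rule eval_ring_hom[OF sub a(1)])
  define d where "d = p \<ominus>\<^bsub>K[X]\<^esub> q"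
  have d: "d \<in> carrier (K[X])" "p = d \<oplus>\<^bsub>K[X]\<^esub> q"
    using pq by (auto simp: d_def UP.minus_eq UP.a_assoc UP.l_neg)
  have "eval p a = eval d a \<oplus> eval q a"
    using d pq by simp
  hence "eval d a = \<zero>"
    using pq E.hom_closed[OF d(1)] E.hom_closed[OF pq(2)] by (metis local.add.r_cancel_one)
  hence "Irr K a pdivides d"
    using Irr_minimal[OF K a d(1)] by simp
  then obtain s where s: "s \<in> carrier (K[X])" "d = Irr K a \<otimes>\<^bsub>K[X]\<^esub> s"
    using pdivides_iff_shell[OF K IrrE(1)[OF K a] d(1)] by (auto simp: factor_def)
  have "poly (coeff_poly h d) y = 0"
    unfolding s(2) poly_coeff_poly_hom(2)[OF IrrE(1)[OF K a] s(1)] y by simp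
  thus ?thesis
    using poly_coeff_poly_hom(1)[OF d(1) pq(2), of y] d(2) by simp
qed

text \<open>
  Every root of the image of the minimal polynomial of \<open>a\<close> gives an extension of the
  homomorphism to \<open>K(a)\<close>, namely evaluation at that root.
\<close>

lemma complex_hom_extend:
  assumes a: "a \<in> carrier R" "(algebraic over K) a"
    and y: "poly (coeff_poly h (Irr K a)) y = 0"
  obtains h' where "complex_hom (simple_extension K a) h'" "\<And>x. x \<in> K \<Longrightarrow> h' x = h x" "h' a = y"
proof -
  have sub: "subring K R" by (rule subfieldE(1)[OF K])
  have KR: "K \<subseteq> carrier R" by (rule subfieldE(3)[OF K])
  interpret E: ring_hom_ring "K[X]" R "\<lambda>p. eval p a"
    by (rule eval_ring_hom[OF sub a(1)])
  define h' where "h' x = poly (coeff_poly h (SOME p. p \<in> carrier (K[X]) \<and> eval p a = x)) y" for x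
  have h': "h' (eval p a) = poly (coeff_poly h p) y" if p: "p \<in> carrier (K[X])" for p
  proof -
    have "\<exists>p'. p' \<in> carrier (K[X]) \<and> eval p' a = eval p a" using p by blast
    from someI_ex[OF this] show ?thesis
      unfolding h'_def using coeff_poly_well_defined[OF a y _ p] by blast
  qed
  have const: "h' k = h k" if "k \<in> K" for k
  proof (cases "k = \<zero>")
    case True
    have "[] \<in> carrier (K[X])" "eval [] a = \<zero>"
      by (auto simp: univ_poly_def polynomial_def)
    thus ?thesis
      using h'[of "[]"] True complex_hom_0[OF K h] by (simp add: coeff_poly_def)
  next
    case False
    have "[k] \<in> carrier (K[X])" "eval [k] a = k"
      using that KR a(1) False by (auto simp: univ_poly_def polynomial_def)
    thus ?thesis
      using h'[of "[k]"] by (simp add: coeff_poly_def)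
  qed
  show ?thesis
  proof (rule that)
    show "h' k = h k" if "k \<in> K" for k
      using const[OF that] .
    have "[\<one>, \<zero>] \<in> carrier (K[X])" "eval [\<one>, \<zero>] a = a"
      using a(1) subringE(2,3)[OF sub] by (auto simp: univ_poly_def polynomial_def)
    thus "h' a = y"
      using h'[of "[\<one>, \<zero>]"] complex_hom_0[OF K h] complex_hom_1[OF K h]
      by (simp add: coeff_poly_def one_pCons[symmetric])
    show "complex_hom (simple_extension K a) h'"
      unfolding complex_hom_def
    proof (intro conjI ballI)
      show "h' \<one> = 1"
        using const[OF subringE(3)[OF sub]] complex_hom_1[OF K h] by simp
      fix u v assume "u \<in> simple_extension K a" "v \<in> simple_extension K a"
      then obtain p q where pq: "p \<in> carrier (K[X])" "u = eval p a" "q \<in> carrier (K[X])" "v = eval q a"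
        using simple_extension_as_eval_img[OF KR a(1)] by auto
      have "u \<oplus> v = eval (p \<oplus>\<^bsub>K[X]\<^esub> q) a" "u \<otimes> v = eval (p \<otimes>\<^bsub>K[X]\<^esub> q) a"
        using pq by auto
      moreover have "p \<oplus>\<^bsub>K[X]\<^esub> q \<in> carrier (K[X])" "p \<otimes>\<^bsub>K[X]\<^esub> q \<in> carrier (K[X])"
        using pq by simp_all
      ultimately show "h' (u \<oplus> v) = h' u + h' v" "h' (u \<otimes> v) = h' u * h' v"
        using h'[of p] h'[of q] h'[of "p \<oplus>\<^bsub>K[X]\<^esub> q"] h'[of "p \<otimes>\<^bsub>K[X]\<^esub> q"]
          poly_coeff_poly_hom[OF pq(1,3)] pq(1,3) unfolding pq(2,4) by metis+
    qed
  qed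
qed

end

text \<open>
  The minimal polynomial of the radical \<open>a\<close> has odd degree, so its image has a real root
  \<open>y\<close>, and sending \<open>a\<close> to \<open>y\<close> is a real embedding. The exponent \<open>m\<close> that exhibits \<open>a\<close> as a
  radical may be even; it is replaced by the degree. For this, all complex roots of the
  minimal polynomial have to have the same modulus, and they do: each is the value at \<open>a\<close>
  of some extension of \<open>h\<close>, so that its \<open>m\<close>-th power is \<open>h (a ^ m)\<close>.
\<close>

lemma odd_radical_step:
  assumes K: "subfield K R" and h: "complex_hom K h" "h ` K \<subseteq> \<real>"
    and rad: "radical_extension K E" and odd: "odd (dim K E)"
  obtains h' n where "complex_hom E h'" "h' ` E \<subseteq> \<real>" "\<And>x. x \<in> K \<Longrightarrow> h' x = h x"
    "radical_tower n (h ` K) (h' ` E)"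
proof -
  obtain a m where a: "a \<in> E" "m > 0" "a [^] (m::nat) \<in> K" "E = simple_extension K a"
    and E: "subfield E R" "K \<subseteq> E"
    using rad by (auto simp: radical_extension_def)
  have aR: "a \<in> carrier R" using a(1) subfieldE(3)[OF E(1)] by blast
  have alg: "(algebraic over K) a"
    using root_imp_algebraic[OF K aR a(3,2)] .
  note Irr = IrrE[OF K aR alg]
  define S where "S = h ` K"
  have S: "real_subfield S"
    unfolding S_def real_subfield_def using complex_hom_image[OF K h(1)] h(2) by blast
  define p where "p = coeff_poly h (Irr K a)"
  obtain l where l: "Irr K a = \<one> # l"
  proof -
    have "Irr K a \<noteq> []"
      using Irr(2) pirreducibleE(1)[OF subfieldE(1)[OF K] Irr(1,2)] by auto
    thus ?thesis using that Irr(3) by (cases "Irr K a") auto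
  qed
  have "set (Irr K a) \<subseteq> K"
    using Irr(1) by (auto simp: univ_poly_def polynomial_def)
  hence "h ` set l \<subseteq> S" by (auto simp: l S_def)
  note p = coeff_poly_monic[OF real_subfieldD(1)[OF S], of h \<one> l, OF complex_hom_1[OF K h(1)] this,
      folded l, folded p_def]
  note deg = p(1) and monic = p(2) and over = p(3)
  have "dim K E = length l"
    using simple_extension_dim[OF K aR alg] a(4) l by (simp add: over_def)
  hence odd_deg: "odd (degree p)" using odd deg by simp
  obtain y where y: "y \<in> \<real>" "poly p y = 0"
    using odd_degree_real_root[OF poly_over_mono[OF real_subfieldD(2)[OF S] over] monic odd_deg] by blast
  have root_pow: "z ^ m = h (a [^] m)" if root: "poly p z = 0" for z
  proof -
    obtain g where g: "complex_hom E g" "\<And>x. x \<in> K \<Longrightarrow> g x = h x" "g a = z"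
      using complex_hom_extend[OF K h(1) aR alg root[unfolded p_def]] a(4) by metis
    show ?thesis
      using complex_hom_pow[OF E(1) g(1) a(1), of m] g(2)[OF a(3)] g(3) by simp
  qed
  have "cmod z = cmod y" if "poly p z = 0" for z
  proof -
    have "cmod z ^ m = cmod y ^ m"
      using root_pow[OF that] root_pow[OF y(2)] by (simp flip: norm_power)
    thus ?thesis
      using a(2) power_eq_imp_eq_base norm_ge_zero by blast
  qed
  hence "y ^ degree p \<in> S"
    using equal_modulus_roots_power_mem[OF S over monic y(1)] by blast
  then obtain n where n: "radical_tower n S (adjoin S y)"
    using radical_tower_odd_power[OF S y(1) odd_deg] by blast
  obtain h' where h': "complex_hom E h'" "\<And>x. x \<in> K \<Longrightarrow> h' x = h x" "h' a = y"
    using complex_hom_extend[OF K h(1) aR alg y(2)[unfolded p_def]] a(4) by metis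
  have "h' ` E = adjoin (h' ` K) y"
    using complex_hom_simple_extension[OF E(1) h'(1) E(2) K a(1)] a(4) h'(3) by simp
  moreover have "h' ` K = S"
    unfolding S_def using h'(2) by (rule image_cong[OF refl])
  ultimately have img: "h' ` E = adjoin S y" by simp
  hence "h' ` E \<subseteq> \<real>"
    using adjoin_real[OF real_subfieldD(2)[OF S] y(1)] by simp
  thus ?thesis
    using that[OF h'(1) _ h'(2)] n img by (simp add: S_def)
qed

lemma radical_chain_finite_dimension:
  assumes rad: "\<And>i. i < r \<Longrightarrow> radical_extension (L i) (L (Suc i))"
    and "i \<le> j" "j \<le> r" and "subfield (L i) R"
  shows "finite_dimension (L i) (L j)"
  using assms(2,3)
proof (induction j rule: dec_induct)
  case base
  show ?case using finite_dimensionI[OF dimension_one[OF assms(4)]] .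
next
  case (step j)
  have "radical_extension (L j) (L (Suc j))" using rad step by simp
  then obtain a m where a: "a \<in> L (Suc j)" "m > 0" "a [^] (m::nat) \<in> L j"
      "L (Suc j) = simple_extension (L j) a" and sub: "subfield (L j) R" "subfield (L (Suc j)) R"
    by (auto simp: radical_extension_def)
  have aR: "a \<in> carrier R" using a(1) subfieldE(3)[OF sub(2)] by blast
  have "finite_dimension (L j) (L (Suc j))"
    using finite_dimension_simple_extension[OF sub(1) aR] root_imp_algebraic[OF sub(1) aR a(3,2)] a(4)
    by simp
  thus ?case
    using telescopic_base_dim(1)[OF assms(4) sub(1)] step by simp
qed

text \<open>
  All steps of the chain have odd degree by multiplicativity, so a real embedding of \<open>Q\<close>
  extends step by step.
\<close>

lemma repeated_radical_odd_embedding: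
  assumes Q: "subfield Q R" and h: "complex_hom Q h" "h ` Q \<subseteq> \<real>"
    and rre: "repeated_radical_extension Q E" and odd: "odd (dim Q E)"
  obtains h' n where "complex_hom E h'" "h' ` E \<subseteq> \<real>" "radical_tower n (h' ` Q) (h' ` E)"
proof -
  obtain r L where L: "L 0 = Q" "L r = E" and sub: "\<And>i. i \<le> r \<Longrightarrow> subfield (L i) R"
    and rad: "\<And>i. i < r \<Longrightarrow> radical_extension (L i) (L (Suc i))"
    using rre by (auto simp: repeated_radical_extension_def)
  have fd: "finite_dimension (L i) (L j)" if "i \<le> j" "j \<le> r" for i j
    using radical_chain_finite_dimension[of r L i j] rad that sub by simp
  have mult: "dim (L i) (L k) = dim (L i) (L j) * dim (L j) (L k)" if "i \<le> j" "j \<le> k" "k \<le> r" for i j k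
    using telescopic_base_dim(2)[OF sub[of i] sub[of j] fd[of i j] fd[of j k]] that
    by (simp add: over_def)
  have odd_step: "odd (dim (L i) (L (Suc i)))" if "i < r" for i
  proof -
    have "dim Q E = dim (L 0) (L i) * dim (L i) (L (Suc i)) * dim (L (Suc i)) (L r)"
      using mult[of 0 "Suc i" r] mult[of 0 i "Suc i"] that by (simp add: L)
    thus ?thesis using odd by simp
  qed
  have "\<exists>h' n. complex_hom (L i) h' \<and> h' ` L i \<subseteq> \<real> \<and> Q \<subseteq> L i \<and> radical_tower n (h' ` Q) (h' ` L i)"
    if "i \<le> r" for i
    using that
  proof (induction i)
    case 0
    show ?case using h L by (auto intro: radical_tower.trivial)
  next
    case (Suc i)
    then obtain g n where g: "complex_hom (L i) g" "g ` L i \<subseteq> \<real>" "Q \<subseteq> L i"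
      "radical_tower n (g ` Q) (g ` L i)"
      by auto
    obtain h' m where h': "complex_hom (L (Suc i)) h'" "h' ` L (Suc i) \<subseteq> \<real>"
      "\<And>x. x \<in> L i \<Longrightarrow> h' x = g x" "radical_tower m (g ` L i) (h' ` L (Suc i))"
      using odd_radical_step[OF _ g(1,2) rad odd_step] sub Suc.prems by (metis Suc_leD Suc_le_lessD)
    have "h' ` Q = g ` Q"
      using h'(3) g(3) by (intro image_cong) auto
    moreover have "L i \<subseteq> L (Suc i)"
      using rad[of i] Suc.prems by (simp add: radical_extension_def)
    ultimately show ?case
      using radical_tower_trans[OF g(4) h'(4)] h' g(3) by fastforce
  qed
  thus ?thesis using that L by blast
qed

lemma is_real_field_complex_hom:
  assumes Q: "subfield Q R" and real: "is_real_field (R\<lparr>carrier := Q\<rparr>)"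
  obtains h where "complex_hom Q h" "h ` Q \<subseteq> \<real>"
proof -
  obtain S h where h: "h \<in> ring_iso (R\<lparr>carrier := Q\<rparr>) ((ring_of_type_algebra :: real ring)\<lparr>carrier := S\<rparr>)"
    using real by (auto simp: is_real_field_def is_ring_iso_def)
  have "complex_hom Q (\<lambda>x. of_real (h x))"
    using h by (auto simp: complex_hom_def ring_iso_def ring_hom_def ring_of_type_algebra_def)
  moreover have "(\<lambda>x. of_real (h x)) ` Q \<subseteq> \<real>" by auto
  ultimately show ?thesis by (rule that)
qed

text \<open>
  A real embedding of \<open>E\<close> transports the claim to subfields of the reals, where it is
  \<open>radical_tower_intermediate\<close>; the resulting tower is pulled back.
\<close>

theorem repeated_radical_extension_intermediate:
  assumes Q: "subfield Q R" and real: "is_real_field (R\<lparr>carrier := Q\<rparr>)"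
    and E: "subfield E R" "repeated_radical_extension Q E" "odd (dim Q E)"
    and K: "subfield K R" "Q \<subseteq> K" "K \<subseteq> E"
  shows "repeated_radical_extension Q K"
proof -
  obtain g where g: "complex_hom Q g" "g ` Q \<subseteq> \<real>"
    using is_real_field_complex_hom[OF Q real] by blast
  obtain h n where h: "complex_hom E h" "h ` E \<subseteq> \<real>" and tower: "radical_tower n (h ` Q) (h ` E)"
    using repeated_radical_odd_embedding[OF Q g E(2,3)] by blast
  have hQ: "complex_hom Q h" and hK: "complex_hom K h"
    using complex_hom_subset[OF h(1)] K by blast+
  have "radical_tower n (h ` Q) (h ` K)"
    using K h(2) complex_hom_image[OF Q hQ]
    by (intro radical_tower_intermediate[OF tower _ complex_hom_image[OF K(1) hK]] image_mono)
      (auto simp: real_subfield_def)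
  thus ?thesis
    using radical_tower_pullback[OF _ refl refl Q K(1,2) hK] K(3) h(2) by blast
qed

end

theorem theoremB:
  fixes L :: "('a, 'b) ring_scheme" and Q K :: "'a set"
  assumes "field L"
    and "subfield Q L"
    and "is_real_field (L \<lparr> carrier := Q \<rparr>)"
    and "ring.repeated_radical_extension L Q (carrier L)"
    and "ring.finite_dimension L Q (carrier L)"
    and "odd (ring.dim L Q (carrier L))"
    and "subfield K L"
    and "Q \<subseteq> K"
  shows "ring.repeated_radical_extension L Q K"
proof -
  interpret field L by fact
  show ?thesis
    using repeated_radical_extension_intermediate[OF assms(2,3) carrier_is_subfield assms(4,6,7,8)]
      subfieldE(3)[OF assms(7)] .
qed

end
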